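(* Let $U^0\in\mathcal{M}^N$ and let $T\in(0,+\infty]$. Suppose that $U(t)\in C^1([0,T);[H_0^1(\Omega)]^N)$ is a solution of $$\frac{\mathrm{d}U}{\mathrm{d}t} = - U \langle \mathcal{G} U, U \rangle + \mathcal{G} U\langle U, U \rangle, \qquad U(0) = U^0 .$$ Then for all $t\in[0,T)$, $$\langle U(t),U(t)\rangle=I_N\qquad\text{and}\qquad \frac{\mathrm{d}E(U(t))}{\mathrm{d}t}\leqslant 0 .$$
   Context: Let $d,N\geqslant 1$ be integers and $\Omega\subset\mathbb{R}^d$ a bounded domain; all functions are real-valued. $(u,v)=\int_\Omega uv$ is the $L^2(\Omega)$ inner product and $\|\cdot\|$ its norm. $\mathcal{V}:\Omega\to\mathbb{R}$ is a potential such that $a(u,v)=\int_\Omega(\nabla u\cdot\nabla v+\mathcal{V}uv)$ is an inner product on $H_0^1(\Omega)$ and there are constants $c_1,c_2>0$ with $c_1\|\nabla u\|^2\leqslant a(u,u)\leqslant c_2\|\nabla u\|^2$ for all $u\in H_0^1(\Omega)$. The operator $\mathcal{G}=(-\Delta+\mathcal{V})^{-1}:H^{-1}(\Omega)\to H_0^1(\Omega)$ is defined by $a(\mathcal{G}f,v)=f(v)$ for all $v\in H_0^1(\Omega)$ (with $f(v)=(f,v)$ if $f\in L^2(\Omega)$), and acts componentwise on $N$-tuples. For $N$-tuples $U=(u_1,\dots,u_N)$, $V=(v_1,\dots,v_N)$, $\langle U,V\rangle\in\mathbb{R}^{N\times N}$ is the matrix with entries $(u_i,v_j)$. For $Q=(q_{ij})\in\mathbb{R}^{N\times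 N}$, $UQ$ is the $N$-tuple with $(UQ)_k=\sum_{i}u_iq_{ik}$. $\mathcal{M}^N=\{U\in[H_0^1(\Omega)]^N:\langle U,U\rangle=I_N\}$. The energy is $E(U)=\frac12\sum_{i=1}^N a(u_i,u_i)$. *)

theory Defs
  imports "HOL-Analysis.Analysis"
begin

text \<open>
  Elements of \<open>L\<^sup>2(\<Omega>)\<close> and of the Sobolev spaces are represented by functions on the whole space, of
  which only the values on \<open>\<Omega>\<close> matter; equality in these spaces is equality almost everywhere
  in \<open>\<Omega>\<close>. Integrals over \<open>\<Omega>\<close> are Lebesgue integrals.
\<close>

definition L2 :: "'a::euclidean_space set \<Rightarrow> ('a \<Rightarrow> 'b::real_normed_vector) set" where
  "L2 \<Omega> = {f \<in> borel_measurable (lebesgue_on \<Omega>). integrable (lebesgue_on \<Omega>) (\<lambda>x. (norm (f x))\<^sup>2)}"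

definition L2_norm :: "'a::euclidean_space set \<Rightarrow> ('a \<Rightarrow> 'b::real_normed_vector) \<Rightarrow> real" where
  "L2_norm \<Omega> f = sqrt (\<integral>x. (norm (f x))\<^sup>2 \<partial>(lebesgue_on \<Omega>))"

definition L2_inner :: "'a::euclidean_space set \<Rightarrow> ('a \<Rightarrow> real) \<Rightarrow> ('a \<Rightarrow> real) \<Rightarrow> real" where
  "L2_inner \<Omega> u v = (\<integral>x. u x * v x \<partial>(lebesgue_on \<Omega>))"


section \<open>Test functions, weak gradients, Sobolev spaces\<close>

definition partial_deriv :: "'a::euclidean_space \<Rightarrow> ('a \<Rightarrow> real) \<Rightarrow> 'a \<Rightarrow> real" where
  "partial_deriv b f x = frechet_derivative f (at x) b"

primrec Ck :: "nat \<Rightarrow> ('a::euclidean_space \<Rightarrow> real) \<Rightarrow> bool" where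
  "Ck 0 f \<longleftrightarrow> continuous_on UNIV f"
| "Ck (Suc k) f \<longleftrightarrow> (\<forall>x. f differentiable (at x)) \<and> (\<forall>b\<in>Basis. Ck k (partial_deriv b f))"

definition test_functions :: "'a::euclidean_space set \<Rightarrow> ('a \<Rightarrow> real) set" where
  "test_functions \<Omega> =
     {\<phi>. (\<forall>k. Ck k \<phi>) \<and> (\<exists>K. compact K \<and> K \<subseteq> \<Omega> \<and> (\<forall>x. x \<notin> K \<longrightarrow> \<phi> x = 0))}"

definition has_weak_gradient ::
    "'a::euclidean_space set \<Rightarrow> ('a \<Rightarrow> real) \<Rightarrow> ('a \<Rightarrow> 'a) \<Rightarrow> bool" where
  "has_weak_gradient \<Omega> u g \<longleftrightarrow>
     (\<forall>\<phi>\<in>test_functions \<Omega>. \<forall>b\<in>Basis.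
        (\<integral>x. u x * partial_deriv b \<phi> x \<partial>(lebesgue_on \<Omega>)) =
        - (\<integral>x. (g x \<bullet> b) * \<phi> x \<partial>(lebesgue_on \<Omega>)))"

definition H1 :: "'a::euclidean_space set \<Rightarrow> ('a \<Rightarrow> real) set" where
  "H1 \<Omega> = {u \<in> L2 \<Omega>. \<exists>g \<in> L2 \<Omega>. has_weak_gradient \<Omega> u g}"

text \<open>The weak gradient of a function in \<open>H\<^sup>1(\<Omega>)\<close>, determined up to a null set.\<close>

definition weak_gradient :: "'a::euclidean_space set \<Rightarrow> ('a \<Rightarrow> real) \<Rightarrow> 'a \<Rightarrow> 'a" where
  "weak_gradient \<Omega> u = (SOME g. g \<in> L2 \<Omega> \<and> has_weak_gradient \<Omega> u g)"

definition H1_norm :: "'a::euclidean_space set \<Rightarrow> ('a \<Rightarrow> real) \<Rightarrow> real" where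
  "H1_norm \<Omega> u = sqrt ((L2_norm \<Omega> u)\<^sup>2 + (L2_norm \<Omega> (weak_gradient \<Omega> u))\<^sup>2)"

definition H01 :: "'a::euclidean_space set \<Rightarrow> ('a \<Rightarrow> real) set" where
  "H01 \<Omega> = {u \<in> H1 \<Omega>. \<exists>\<phi>. (\<forall>n::nat. \<phi> n \<in> test_functions \<Omega>) \<and>
                         (\<lambda>n. H1_norm \<Omega> (\<lambda>x. \<phi> n x - u x)) \<longlonglongrightarrow> 0}"


section \<open>The bilinear form and the solution operator\<close>

definition bilin ::
    "'a::euclidean_space set \<Rightarrow> ('a \<Rightarrow> real) \<Rightarrow> ('a \<Rightarrow> real) \<Rightarrow> ('a \<Rightarrow> real) \<Rightarrow> real" where
  "bilin \<Omega> \<V> u v =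
     (\<integral>x. weak_gradient \<Omega> u x \<bullet> weak_gradient \<Omega> v x + \<V> x * u x * v x \<partial>(lebesgue_on \<Omega>))"

definition inner_product_on_H01 ::
    "'a::euclidean_space set \<Rightarrow> (('a \<Rightarrow> real) \<Rightarrow> ('a \<Rightarrow> real) \<Rightarrow> real) \<Rightarrow> bool" where
  "inner_product_on_H01 \<Omega> B \<longleftrightarrow>
     (\<forall>u\<in>H01 \<Omega>. \<forall>v\<in>H01 \<Omega>. B u v = B v u) \<and>
     (\<forall>u\<in>H01 \<Omega>. \<forall>v\<in>H01 \<Omega>. \<forall>w\<in>H01 \<Omega>. B (\<lambda>x. u x + v x) w = B u w + B v w) \<and>
     (\<forall>c. \<forall>u\<in>H01 \<Omega>. \<forall>v\<in>H01 \<Omega>. B (\<lambda>x. c * u x) v = c * B u v) \<and>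
     (\<forall>u\<in>H01 \<Omega>. 0 \<le> B u u) \<and>
     (\<forall>u\<in>H01 \<Omega>. B u u = 0 \<longrightarrow> (AE x in lebesgue_on \<Omega>. u x = 0))"

text \<open>
  The operator \<open>(-\<Delta> + \<V>)\<inverse>\<close>. Its argument is a functional on \<open>H\<^sub>0\<^sup>1(\<Omega>)\<close>; the value is
  meaningful if that functional lies in the dual \<open>H\<^sup>-\<^sup>1(\<Omega>)\<close>, and is then determined up to a null
  set (Riesz). A function \<open>u\<close> in \<open>L\<^sup>2(\<Omega>)\<close> is identified with the functional \<open>v \<mapsto> (u, v)\<close>.
\<close>

definition solution_op ::
    "'a::euclidean_space set \<Rightarrow> ('a \<Rightarrow> real) \<Rightarrow> (('a \<Rightarrow> real) \<Rightarrow> real) \<Rightarrow> 'a \<Rightarrow> real" where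
  "solution_op \<Omega> \<V> f = (SOME w. w \<in> H01 \<Omega> \<and> (\<forall>v\<in>H01 \<Omega>. bilin \<Omega> \<V> w v = f v))"


section \<open>Tuples of functions\<close>

definition solution_op_tuple ::
    "'a::euclidean_space set \<Rightarrow> ('a \<Rightarrow> real) \<Rightarrow> ('a \<Rightarrow> real)^'n \<Rightarrow> ('a \<Rightarrow> real)^'n" where
  "solution_op_tuple \<Omega> \<V> U = (\<chi> i. solution_op \<Omega> \<V> (L2_inner \<Omega> (U $ i)))"

definition gram ::
    "'a::euclidean_space set \<Rightarrow> ('a \<Rightarrow> real)^'n \<Rightarrow> ('a \<Rightarrow> real)^'n \<Rightarrow> real^'n^'n" where
  "gram \<Omega> U V = (\<chi> i j. L2_inner \<Omega> (U $ i) (V $ j))"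

definition tuple_mult :: "('a \<Rightarrow> real)^'n \<Rightarrow> real^'n^'n \<Rightarrow> ('a \<Rightarrow> real)^'n" where
  "tuple_mult U Q = (\<chi> k. (\<lambda>x. \<Sum>i\<in>UNIV. (U $ i) x * Q $ i $ k))"

definition tuple_add :: "('a \<Rightarrow> real)^'n \<Rightarrow> ('a \<Rightarrow> real)^'n \<Rightarrow> ('a \<Rightarrow> real)^'n" where
  "tuple_add U V = (\<chi> i. (\<lambda>x. (U $ i) x + (V $ i) x))"

definition tuple_diff :: "('a \<Rightarrow> real)^'n \<Rightarrow> ('a \<Rightarrow> real)^'n \<Rightarrow> ('a \<Rightarrow> real)^'n" where
  "tuple_diff U V = (\<chi> i. (\<lambda>x. (U $ i) x - (V $ i) x))"

definition tuple_scale :: "real \<Rightarrow> ('a \<Rightarrow> real)^'n \<Rightarrow> ('a \<Rightarrow> real)^'n" where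
  "tuple_scale c U = (\<chi> i. (\<lambda>x. c * (U $ i) x))"

definition tuple_eq ::
    "'a::euclidean_space set \<Rightarrow> ('a \<Rightarrow> real)^'n \<Rightarrow> ('a \<Rightarrow> real)^'n \<Rightarrow> bool" where
  "tuple_eq \<Omega> U V \<longleftrightarrow> (\<forall>i. AE x in lebesgue_on \<Omega>. (U $ i) x = (V $ i) x)"

definition H01_tuples :: "'a::euclidean_space set \<Rightarrow> (('a \<Rightarrow> real)^'n) set" where
  "H01_tuples \<Omega> = {U. \<forall>i. U $ i \<in> H01 \<Omega>}"

definition tuple_norm :: "'a::euclidean_space set \<Rightarrow> ('a \<Rightarrow> real)^'n \<Rightarrow> real" where
  "tuple_norm \<Omega> U = sqrt (\<Sum>i\<in>UNIV. (H1_norm \<Omega> (U $ i))\<^sup>2)"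

definition orthonormal_tuples :: "'a::euclidean_space set \<Rightarrow> (('a \<Rightarrow> real)^'n) set" where
  "orthonormal_tuples \<Omega> = {U \<in> H01_tuples \<Omega>. gram \<Omega> U U = mat 1}"

definition energy ::
    "'a::euclidean_space set \<Rightarrow> ('a \<Rightarrow> real) \<Rightarrow> ('a \<Rightarrow> real)^'n \<Rightarrow> real" where
  "energy \<Omega> \<V> U = 1 / 2 * (\<Sum>i\<in>UNIV. bilin \<Omega> \<V> (U $ i) (U $ i))"


section \<open>Continuously differentiable curves and the flow\<close>

definition time_interval :: "ereal \<Rightarrow> real set" where
  "time_interval T = {t. 0 \<le> t \<and> ereal t < T}"

text \<open>
  \<open>U \<in> C\<^sup>1([0,T); [H\<^sub>0\<^sup>1(\<Omega>)]\<^sup>N)\<close> with derivative \<open>U'\<close>, limits being taken in the norm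
  of \<open>[H\<^sub>0\<^sup>1(\<Omega>)]\<^sup>N\<close> and within \<open>[0,T)\<close>, hence one-sided at \<open>0\<close>.
\<close>

definition C1_curve ::
    "'a::euclidean_space set \<Rightarrow> ereal \<Rightarrow> (real \<Rightarrow> ('a \<Rightarrow> real)^'n) \<Rightarrow> (real \<Rightarrow> ('a \<Rightarrow> real)^'n) \<Rightarrow> bool"
  where
  "C1_curve \<Omega> T U U' \<longleftrightarrow>
     (\<forall>t\<in>time_interval T.
        U t \<in> H01_tuples \<Omega> \<and> U' t \<in> H01_tuples \<Omega> \<and>
        ((\<lambda>s. tuple_norm \<Omega>
                (tuple_diff (tuple_scale (1 / (s - t)) (tuple_diff (U s) (U t))) (U' t)))
           \<longlongrightarrow> 0) (at t within time_interval T) \<and>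
        ((\<lambda>s. tuple_norm \<Omega> (tuple_diff (U' s) (U' t))) \<longlongrightarrow> 0) (at t within time_interval T))"

definition flow_rhs ::
    "'a::euclidean_space set \<Rightarrow> ('a \<Rightarrow> real) \<Rightarrow> ('a \<Rightarrow> real)^'n \<Rightarrow> ('a \<Rightarrow> real)^'n" where
  "flow_rhs \<Omega> \<V> U =
     (let GU = solution_op_tuple \<Omega> \<V> U
      in tuple_add (tuple_scale (- 1) (tuple_mult U (gram \<Omega> GU U)))
                   (tuple_mult GU (gram \<Omega> U U)))"

end

theory Submission
  imports Defs
begin

text \<open>
  Let \<open>A = \<langle>U, U\<rangle>\<close>, \<open>P = \<langle>\<G> U, U\<rangle>\<close> and \<open>S = (a(u\<^sub>i, u\<^sub>j))\<close>. The equation gives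
  \<open>\<langle>U', U\<rangle> = A P - P A\<close>, which is antisymmetric, so \<open>A\<close> is constant. With \<open>A = I\<close> the derivative of the
  energy is \<open>N - tr (P S)\<close>. As \<open>P = (a(\<G> u\<^sub>i, \<G> u\<^sub>j))\<close> and \<open>a(\<G> u\<^sub>i, u\<^sub>j) = \<delta>\<^sub>i\<^sub>j\<close>, the number \<open>tr (P S)\<close> is
  the squared Hilbert--Schmidt norm of a projection of rank \<open>N\<close>, hence at least \<open>N\<close>.
  All of this rests on the defining property of \<open>\<G>\<close>, that is, on the Riesz representation theorem:
  \<open>H\<^sub>0\<^sup>1(\<Omega>)\<close> has to be complete in the norm of \<open>a\<close>, by the completeness of \<open>L\<^sup>2(\<Omega>)\<close>, the Poincare
  inequality and the uniqueness of weak gradients.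
\<close>


text \<open>Functions are representatives here, and \<open>weak_gradient\<close> and
  \<open>solution_op\<close> are arbitrary choices, so the flow equation and all rules for gradients
  hold only almost everywhere. The proof therefore works with semi-inner products, where a nonzero
  function may have norm 0 and limits need not be unique, and never forms a quotient. The price is
  that each form must be shown insensitive to null sets; for the energy form this is read off from
  the upper bound with \<open>c2\<close>. Uniqueness of weak gradients is what makes the chosen
  gradient linear up to null sets. Why the trace is at least N: the matrix P S belongs to the
  projection onto the span of the u_i along the a-orthogonal complement of the \<G> u_i. This
  projection is oblique in general. A projection of rank N has N nonzero singular values, all at
  least 1, and their squares add up to tr (P S). The formal proof replaces singular values by an
  induction with Cauchy-Schwarz.\<close>

section \<open>Semi-inner products on spaces of functions\<close>

text \<open>Discriminant criterion. The case c = 0 is kept because the forms are only semidefinite.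
  It serves for Cauchy-Schwarz and, with a = 0, for the first-order condition at a
  minimiser.\<close>

lemma nonneg_quadratic_imp:
  fixes a b c :: real
  assumes "0 \<le> c" "\<And>t. 0 \<le> a + 2 * t * b + t\<^sup>2 * c"
  shows "b\<^sup>2 \<le> a * c"
proof (cases "c = 0")
  case True
  have "b = 0"
  proof (rule ccontr)
    assume "b \<noteq> 0"
    \<comment> \<open>This t makes the affine function a + 2 t b equal to -1.\<close>
    then show False using assms(2)[of "- (a + 1) / (2 * b)"] True by (simp add: field_simps)
  qed
  then show ?thesis using True by simp
next
  case False
  then have "0 < c" using \<open>0 \<le> c\<close> by simp
  then show ?thesis using assms(2)[of "- b / c"] by (simp add: field_simps power2_eq_square)
qed

lemma power2_le_if_power2_le_mult:
  fixes a b :: real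
  assumes "0 \<le> a" "0 \<le> b" "a\<^sup>2 \<le> b * a"
  shows "a \<le> b"
  using assms by (cases "a = 0") (auto simp: power2_eq_square)

text \<open>A carrier set in a function type, since \<open>L2\<close>, \<open>H1\<close> and
  \<open>H01\<close> are sets of functions that are not identified when equal almost everywhere;
  hence no definiteness. The algebraic laws are demanded on V only, because integrals of other
  functions carry no information.\<close>

locale semi_inner =
  fixes V :: "('a \<Rightarrow> 'b::real_vector) set" and B :: "('a \<Rightarrow> 'b) \<Rightarrow> ('a \<Rightarrow> 'b) \<Rightarrow> real"
  assumes zero_mem: "(\<lambda>x. 0) \<in> V"
    and add_mem: "u \<in> V \<Longrightarrow> v \<in> V \<Longrightarrow> (\<lambda>x. u x + v x) \<in> V"
    and scale_mem: "u \<in> V \<Longrightarrow> (\<lambda>x. c *\<^sub>R u x) \<in> V"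
    and sym: "u \<in> V \<Longrightarrow> v \<in> V \<Longrightarrow> B u v = B v u"
    and add_left: "u \<in> V \<Longrightarrow> v \<in> V \<Longrightarrow> w \<in> V \<Longrightarrow> B (\<lambda>x. u x + v x) w = B u w + B v w"
    and scale_left: "u \<in> V \<Longrightarrow> v \<in> V \<Longrightarrow> B (\<lambda>x. c *\<^sub>R u x) v = c * B u v"
    and nonneg: "u \<in> V \<Longrightarrow> 0 \<le> B u u"
begin

definition nrm :: "('a \<Rightarrow> 'b) \<Rightarrow> real" where "nrm u = sqrt (B u u)"

lemma diff_mem: "u \<in> V \<Longrightarrow> v \<in> V \<Longrightarrow> (\<lambda>x. u x - v x) \<in> V"
  using add_mem[of u "\<lambda>x. (-1) *\<^sub>R v x"] scale_mem[of v "-1"] by simp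

lemma add_right: "u \<in> V \<Longrightarrow> v \<in> V \<Longrightarrow> w \<in> V \<Longrightarrow> B w (\<lambda>x. u x + v x) = B w u + B w v"
  by (simp only: sym[of w] add_mem add_left)

lemma scale_right: "u \<in> V \<Longrightarrow> v \<in> V \<Longrightarrow> B v (\<lambda>x. c *\<^sub>R u x) = c * B v u"
  by (simp only: sym[of v] scale_mem scale_left)

lemma diff_left: "u \<in> V \<Longrightarrow> v \<in> V \<Longrightarrow> w \<in> V \<Longrightarrow> B (\<lambda>x. u x - v x) w = B u w - B v w"
  using add_left[of u "\<lambda>x. (-1) *\<^sub>R v x" w] scale_left[of v w "-1"] scale_mem[of v "-1"] by simp

lemma diff_right: "u \<in> V \<Longrightarrow> v \<in> V \<Longrightarrow> w \<in> V \<Longrightarrow> B w (\<lambda>x. u x - v x) = B w u - B w v"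
  by (simp only: sym[of w] diff_mem diff_left)

lemma zero_left: "v \<in> V \<Longrightarrow> B (\<lambda>x. 0) v = 0"
  using scale_left[OF zero_mem, of v 0] by simp

lemmas bilinear = add_mem scale_mem diff_mem add_left add_right scale_left scale_right
  diff_left diff_right

lemma sum_mem:
  assumes "\<And>i. i \<in> F \<Longrightarrow> u i \<in> V"
  shows "(\<lambda>x. \<Sum>i\<in>F. c i *\<^sub>R u i x) \<in> V"
  using assms
proof (induction F rule: infinite_finite_induct)
  case (insert i F)
  have "(\<lambda>x. c i *\<^sub>R u i x + (\<Sum>i\<in>F. c i *\<^sub>R u i x)) \<in> V"
    by (intro add_mem scale_mem insert.IH insert.prems insertI1 insertI2)
  then show ?case using insert.hyps by simp
qed (simp_all add: zero_mem)

lemma sum_left: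
  assumes "\<And>i. i \<in> F \<Longrightarrow> u i \<in> V" "w \<in> V"
  shows "B (\<lambda>x. \<Sum>i\<in>F. c i *\<^sub>R u i x) w = (\<Sum>i\<in>F. c i * B (u i) w)"
  using assms
proof (induction F rule: infinite_finite_induct)
  case (insert i F)
  have ui: "u i \<in> V" and F: "\<And>j. j \<in> F \<Longrightarrow> u j \<in> V" by (simp_all only: insert.prems insert_iff simp_thms)
  have "B (\<lambda>x. c i *\<^sub>R u i x + (\<Sum>i\<in>F. c i *\<^sub>R u i x)) w
      = B (\<lambda>x. c i *\<^sub>R u i x) w + B (\<lambda>x. \<Sum>i\<in>F. c i *\<^sub>R u i x) w"
    by (rule add_left[OF scale_mem[OF ui] sum_mem[OF F] insert.prems(2)])
  then show ?case
    using insert.hyps insert.IH[OF F insert.prems(2)] scale_left[OF ui insert.prems(2)] by simp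
qed (simp_all add: zero_left)

lemma sum_right:
  assumes "\<And>i. i \<in> F \<Longrightarrow> u i \<in> V" "w \<in> V"
  shows "B w (\<lambda>x. \<Sum>i\<in>F. c i *\<^sub>R u i x) = (\<Sum>i\<in>F. c i * B w (u i))"
proof -
  have "B w (\<lambda>x. \<Sum>i\<in>F. c i *\<^sub>R u i x) = (\<Sum>i\<in>F. c i * B (u i) w)"
    by (simp only: sym[OF assms(2) sum_mem[OF assms(1)]] sum_left[OF assms])
  also have "\<dots> = (\<Sum>i\<in>F. c i * B w (u i))"
    using assms by (intro sum.cong refl) (simp only: sym[of _ w])
  finally show ?thesis .
qed

lemma nrm_power2: "u \<in> V \<Longrightarrow> (nrm u)\<^sup>2 = B u u"
  by (simp add: nrm_def nonneg)

lemma nrm_nonneg: "u \<in> V \<Longrightarrow> 0 \<le> nrm u"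
  by (simp add: nrm_def nonneg)

lemma Cauchy_Schwarz_power2:
  assumes "u \<in> V" "v \<in> V"
  shows "(B u v)\<^sup>2 \<le> B u u * B v v"
proof (rule nonneg_quadratic_imp[OF nonneg[OF assms(2)]])
  fix t
  have "0 \<le> B (\<lambda>x. u x + t *\<^sub>R v x) (\<lambda>x. u x + t *\<^sub>R v x)"
    using assms by (intro nonneg add_mem scale_mem)
  also have "\<dots> = B u u + 2 * t * B u v + t\<^sup>2 * B v v"
    using assms by (simp add: bilinear sym[of v u] power2_eq_square algebra_simps)
  finally show "0 \<le> B u u + 2 * t * B u v + t\<^sup>2 * B v v" .
qed

lemma Cauchy_Schwarz: "u \<in> V \<Longrightarrow> v \<in> V \<Longrightarrow> \<bar>B u v\<bar> \<le> nrm u * nrm v"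
  using real_sqrt_le_mono[OF Cauchy_Schwarz_power2[of u v]] by (simp add: nrm_def real_sqrt_mult)

lemma nrm_triangle:
  assumes "u \<in> V" "v \<in> V"
  shows "nrm (\<lambda>x. u x + v x) \<le> nrm u + nrm v"
proof (rule power2_le_imp_le)
  have "(nrm (\<lambda>x. u x + v x))\<^sup>2 = (nrm u)\<^sup>2 + 2 * B u v + (nrm v)\<^sup>2"
    using assms by (simp add: nrm_power2 bilinear sym[of v u])
  then show "(nrm (\<lambda>x. u x + v x))\<^sup>2 \<le> (nrm u + nrm v)\<^sup>2"
    using Cauchy_Schwarz[OF assms] by (simp add: power2_sum)
qed (use assms nrm_nonneg in auto)

lemma nrm_scale: "u \<in> V \<Longrightarrow> nrm (\<lambda>x. c *\<^sub>R u x) = \<bar>c\<bar> * nrm u"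
  by (simp add: nrm_def bilinear real_sqrt_mult flip: mult.assoc)

lemma nrm_diff_commute:
  assumes "u \<in> V" "v \<in> V"
  shows "nrm (\<lambda>x. u x - v x) = nrm (\<lambda>x. v x - u x)"
  using nrm_scale[OF diff_mem[OF assms], of "-1"] by simp

lemma nrm_triangle_diff:
  assumes "u \<in> V" "v \<in> V" "w \<in> V"
  shows "nrm (\<lambda>x. u x - w x) \<le> nrm (\<lambda>x. u x - v x) + nrm (\<lambda>x. v x - w x)"
  using nrm_triangle[OF diff_mem[OF assms(1,2)] diff_mem[OF assms(2,3)]] by simp

lemma nrm_le_diff:
  assumes "u \<in> V" "v \<in> V"
  shows "nrm u \<le> nrm (\<lambda>x. u x - v x) + nrm v"
  using nrm_triangle[OF diff_mem[OF assms] assms(2)] by simp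

section \<open>Limits and derivatives of the form along curves\<close>

lemma tendsto_left:
  assumes "\<forall>\<^sub>F s in \<F>. u s \<in> V" "l \<in> V" "w \<in> V"
    and "((\<lambda>s. nrm (\<lambda>x. u s x - l x)) \<longlongrightarrow> 0) \<F>"
  shows "((\<lambda>s. B (u s) w) \<longlongrightarrow> B l w) \<F>"
proof -
  have "((\<lambda>s. B (u s) w - B l w) \<longlongrightarrow> 0) \<F>"
  proof (rule Lim_null_comparison)
    show "\<forall>\<^sub>F s in \<F>. norm (B (u s) w - B l w) \<le> nrm (\<lambda>x. u s x - l x) * nrm w"
      using assms(1)
    proof eventually_elim
      case (elim s)
      then show ?case
        using Cauchy_Schwarz[OF diff_mem[of "u s" l] \<open>w \<in> V\<close>] assms by (simp add: diff_left)
    qed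
    show "((\<lambda>s. nrm (\<lambda>x. u s x - l x) * nrm w) \<longlongrightarrow> 0) \<F>"
      using tendsto_mult_right[OF assms(4), of "nrm w"] by simp
  qed
  then show ?thesis by (rule LIM_zero_cancel)
qed

lemma tendsto_right:
  assumes "\<forall>\<^sub>F s in \<F>. u s \<in> V" "l \<in> V" "w \<in> V"
    and "((\<lambda>s. nrm (\<lambda>x. u s x - l x)) \<longlongrightarrow> 0) \<F>"
  shows "((\<lambda>s. B w (u s)) \<longlongrightarrow> B w l) \<F>"
proof -
  have "\<forall>\<^sub>F s in \<F>. B (u s) w = B w (u s)"
    by (rule eventually_mono[OF assms(1)]) (rule sym[OF _ assms(3)])
  then show ?thesis
    unfolding sym[OF assms(3,2)] by (rule Lim_transform_eventually[OF tendsto_left[OF assms]])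
qed

lemma tendsto_self:
  assumes "\<forall>\<^sub>F s in \<F>. u s \<in> V" "l \<in> V"
    and "((\<lambda>s. nrm (\<lambda>x. u s x - l x)) \<longlongrightarrow> 0) \<F>"
  shows "((\<lambda>s. B (u s) (u s)) \<longlongrightarrow> B l l) \<F>"
proof -
  \<comment> \<open>Expanding the square of \<open>nrm\<close> at u s - l expresses
    \<open>B (u s) (u s)\<close> by terms in which only one argument moves.\<close>
  have "((\<lambda>s. (nrm (\<lambda>x. u s x - l x))\<^sup>2 + B (u s) l + B l (u s) - B l l) \<longlongrightarrow> 0\<^sup>2 + B l l + B l l - B l l) \<F>"
    using assms by (intro tendsto_intros tendsto_left tendsto_right)
  moreover have "\<forall>\<^sub>F s in \<F>. (nrm (\<lambda>x. u s x - l x))\<^sup>2 + B (u s) l + B l (u s) - B l l = B (u s) (u s)"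
    using assms(1) by eventually_elim (simp add: assms(2) nrm_power2 bilinear)
  ultimately have "((\<lambda>s. B (u s) (u s)) \<longlongrightarrow> 0\<^sup>2 + B l l + B l l - B l l) \<F>"
    by (rule Lim_transform_eventually)
  then show ?thesis by simp
qed

text \<open>Product rule: with the difference quotients d and e of u and v, the quotient of
  \<open>B (u s) (v s)\<close> is
  \<open>B (d s) (v t) + B (u t) (e s) + (s - t) * B (d s) (e s)\<close>. The last term dies out
  because d and e stay bounded in \<open>nrm\<close>. Limits within S include the one-sided
  derivative at time 0.\<close>

lemma has_derivative_form:
  assumes "t \<in> S"
    and u: "\<And>s. s \<in> S \<Longrightarrow> u s \<in> V" "u' \<in> V"
      "((\<lambda>s. nrm (\<lambda>x. (1 / (s - t)) *\<^sub>R (u s x - u t x) - u' x)) \<longlongrightarrow> 0) (at t within S)"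
    and v: "\<And>s. s \<in> S \<Longrightarrow> v s \<in> V" "v' \<in> V"
      "((\<lambda>s. nrm (\<lambda>x. (1 / (s - t)) *\<^sub>R (v s x - v t x) - v' x)) \<longlongrightarrow> 0) (at t within S)"
  shows "((\<lambda>s. B (u s) (v s)) has_real_derivative B u' (v t) + B (u t) v') (at t within S)"
proof -
  define d where "d s x = (1 / (s - t)) *\<^sub>R (u s x - u t x)" for s x
  define e where "e s x = (1 / (s - t)) *\<^sub>R (v s x - v t x)" for s x
  have mem: "d s \<in> V" "e s \<in> V" if "s \<in> S" for s
    unfolding d_def e_def using that assms(1) u(1) v(1) by (intro scale_mem diff_mem; simp)+
  have S: "\<forall>\<^sub>F s in at t within S. s \<in> S"
    by (simp add: eventually_at_filter)
  have ne: "\<forall>\<^sub>F s in at t within S. s \<noteq> t"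
    by (simp add: eventually_at_filter)
  have memS: "\<forall>\<^sub>F s in at t within S. d s \<in> V" "\<forall>\<^sub>F s in at t within S. e s \<in> V"
    using S by (eventually_elim; simp add: mem)+
  have lim: "((\<lambda>s. nrm (\<lambda>x. d s x - u' x)) \<longlongrightarrow> 0) (at t within S)"
    "((\<lambda>s. nrm (\<lambda>x. e s x - v' x)) \<longlongrightarrow> 0) (at t within S)"
    using u(3) v(3) by (simp_all add: d_def e_def)
  have vt: "v t \<in> V" "u t \<in> V" using assms by auto
  \<comment> \<open>Majorant of the last term: the seminorm of d s is at most that of d s - u' plus
    that of u', and likewise for e s.\<close>
  have "((\<lambda>s. (s - t) * (nrm (\<lambda>x. d s x - u' x) + nrm u') * (nrm (\<lambda>x. e s x - v' x) + nrm v')) \<longlongrightarrow>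
      (t - t) * (0 + nrm u') * (0 + nrm v')) (at t within S)"
    by (intro tendsto_intros lim)
  then have lim0: "((\<lambda>s. (s - t) * (nrm (\<lambda>x. d s x - u' x) + nrm u') * (nrm (\<lambda>x. e s x - v' x) + nrm v')) \<longlongrightarrow> 0) (at t within S)"
    by simp
  have "((\<lambda>s. (s - t) * B (d s) (e s)) \<longlongrightarrow> 0) (at t within S)"
  proof (rule Lim_null_comparison[OF _ tendsto_norm_zero[OF lim0]])
    show "\<forall>\<^sub>F s in at t within S. norm ((s - t) * B (d s) (e s)) \<le>
      norm ((s - t) * (nrm (\<lambda>x. d s x - u' x) + nrm u') * (nrm (\<lambda>x. e s x - v' x) + nrm v'))"
      using S
    proof eventually_elim
      case (elim s)
      have "\<bar>B (d s) (e s)\<bar> \<le> nrm (d s) * nrm (e s)"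
        by (intro Cauchy_Schwarz mem elim)
      also have "\<dots> \<le> (nrm (\<lambda>x. d s x - u' x) + nrm u') * (nrm (\<lambda>x. e s x - v' x) + nrm v')"
        using elim u(2) v(2) mem
        by (intro mult_mono nrm_le_diff add_nonneg_nonneg nrm_nonneg) (auto intro!: diff_mem)
      finally have "\<bar>s - t\<bar> * \<bar>B (d s) (e s)\<bar> \<le> \<bar>s - t\<bar> *
         ((nrm (\<lambda>x. d s x - u' x) + nrm u') * (nrm (\<lambda>x. e s x - v' x) + nrm v'))"
        by (intro mult_left_mono) auto
      also have "\<dots> \<le> \<bar>s - t\<bar> *
         \<bar>(nrm (\<lambda>x. d s x - u' x) + nrm u') * (nrm (\<lambda>x. e s x - v' x) + nrm v')\<bar>"
        by (intro mult_left_mono) auto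
      finally show ?case by (simp add: abs_mult mult.assoc)
    qed
  qed
  then have "((\<lambda>s. B (d s) (v t) + B (u t) (e s) + (s - t) * B (d s) (e s)) \<longlongrightarrow>
      B u' (v t) + B (u t) v' + 0) (at t within S)"
    using memS vt u(2) v(2) lim by (intro tendsto_add tendsto_left tendsto_right)
  moreover have "\<forall>\<^sub>F s in at t within S.
      B (d s) (v t) + B (u t) (e s) + (s - t) * B (d s) (e s) =
      (B (u s) (v s) - B (u t) (v t)) / (s - t)"
    using S ne
  proof eventually_elim
    case (elim s)
    have "B (d s) (v t) + B (u t) (e s) + (s - t) * B (d s) (e s) =
       (B (u s) (v t) - B (u t) (v t)) / (s - t) + (B (u t) (v s) - B (u t) (v t)) / (s - t)
       + (s - t) * (((B (u s) (v s) - B (u t) (v s)) - (B (u s) (v t) - B (u t) (v t))) / (s - t) / (s - t))"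
      unfolding d_def e_def using elim assms by (simp add: bilinear)
    also have "\<dots> = (B (u s) (v s) - B (u t) (v t)) / (s - t)"
    proof -
      have *: "r * (z / r / r) = z / r" if "r \<noteq> 0" for r z :: real
        using that by simp
      show ?thesis using elim by (subst *) (simp_all add: diff_divide_distrib)
    qed
    finally show ?case .
  qed
  ultimately show ?thesis
    unfolding has_field_derivative_iff add_0_right by (rule Lim_transform_eventually)
qed

text \<open>Direct method: w is found as a minimiser of the quadratic functional J, whose
  first-order condition is the claim. The parallelogram law makes a minimising sequence Cauchy.
  Completeness is needed only for the seminorm, so it does not matter that the limit is not
  unique.\<close>

lemma Riesz:
  assumes complete: "\<And>w. (\<And>n. w n \<in> V) \<Longrightarrow>
        (\<And>e. e > 0 \<Longrightarrow> \<exists>N. \<forall>m\<ge>N. \<forall>n\<ge>N. nrm (\<lambda>x. w m x - w n x) < e) \<Longrightarrow>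
        \<exists>l\<in>V. (\<lambda>n. nrm (\<lambda>x. w n x - l x)) \<longlonglongrightarrow> 0"
    and f_add: "\<And>u v. u \<in> V \<Longrightarrow> v \<in> V \<Longrightarrow> f (\<lambda>x. u x + v x) = f u + f v"
    and f_scale: "\<And>c u. u \<in> V \<Longrightarrow> f (\<lambda>x. c *\<^sub>R u x) = c * f u"
    and f_bound: "\<And>u. u \<in> V \<Longrightarrow> \<bar>f u\<bar> \<le> C * nrm u"
  shows "\<exists>w\<in>V. \<forall>v\<in>V. B w v = f v"
proof -
  define J where "J v = B v v - 2 * f v" for v
  have f_diff: "f (\<lambda>x. u x - v x) = f u - f v" if "u \<in> V" "v \<in> V" for u v
    using f_add[OF that(1) scale_mem[OF that(2)], of "-1"] f_scale[OF that(2), of "-1"] by simp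
  \<comment> \<open>Completing the square: 2 C |v| is at most C^2 + |v|^2.\<close>
  have J_ge: "- C\<^sup>2 \<le> J v" if "v \<in> V" for v
  proof -
    have "2 * f v \<le> 2 * (C * nrm v)" using f_bound[OF that] by linarith
    also have "\<dots> \<le> C\<^sup>2 + (nrm v)\<^sup>2" using sum_squares_bound[of C "nrm v"] by simp
    finally show ?thesis by (simp add: J_def nrm_power2[OF that])
  qed
  define m where "m = Inf (J ` V)"
  have bdd: "bdd_below (J ` V)" by (rule bdd_belowI2[OF J_ge])
  have m_le: "m \<le> J v" if "v \<in> V" for v
    unfolding m_def using that bdd by (rule cINF_lower[rotated])
  have "\<exists>v\<in>V. J v < m + 1 / real (Suc n)" for n
  proof -
    have "Inf (J ` V) < m + 1 / real (Suc n)" by (simp add: m_def)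
    then show ?thesis using cInf_lessD[of "J ` V"] zero_mem by blast
  qed
  then obtain w where w: "\<And>n. w n \<in> V" "\<And>n. J (w n) < m + 1 / real (Suc n)" by metis
  \<comment> \<open>Parallelogram law: J at the midpoint is at least the infimum m, so its fourfold
    cancels the 4 m contained in the bounds for \<open>J (w i)\<close> and
    \<open>J (w j)\<close>.\<close>
  have par: "(nrm (\<lambda>x. w i x - w j x))\<^sup>2 \<le> 2 / real (Suc i) + 2 / real (Suc j)" for i j
  proof -
    have mid: "(\<lambda>x. (1/2) *\<^sub>R (w i x + w j x)) \<in> V" using w by (intro scale_mem add_mem)
    have "(nrm (\<lambda>x. w i x - w j x))\<^sup>2
        = 2 * J (w i) + 2 * J (w j) - 4 * J (\<lambda>x. (1/2) *\<^sub>R (w i x + w j x))"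
      unfolding J_def using w
      by (simp only: nrm_power2 bilinear f_add f_scale) (simp add: field_simps)
    also have "\<dots> \<le> 2 * (1 / real (Suc i)) + 2 * (1 / real (Suc j))"
      using w(2)[of i] w(2)[of j] m_le[OF mid] by linarith
    finally show ?thesis by simp
  qed
  have cauchy: "\<exists>N. \<forall>i\<ge>N. \<forall>j\<ge>N. nrm (\<lambda>x. w i x - w j x) < e" if "e > 0" for e
  proof -
    obtain N where N: "4 / e\<^sup>2 < real N" using reals_Archimedean2 by blast
    have "nrm (\<lambda>x. w i x - w j x) < e" if "i \<ge> N" "j \<ge> N" for i j
    proof (rule power2_less_imp_less)
      have N0: "0 < real N" using N \<open>e > 0\<close> by (smt (verit) divide_pos_pos zero_less_power)
      have "2 / real (Suc i) + 2 / real (Suc j) \<le> 2 / real N + 2 / real N"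
        using that N0 by (intro add_mono divide_left_mono) auto
      also have "\<dots> = 4 / real N" by simp
      also have "\<dots> < e\<^sup>2" using N N0 \<open>e > 0\<close> by (simp add: field_simps)
      finally show "(nrm (\<lambda>x. w i x - w j x))\<^sup>2 < e\<^sup>2" using par[of i j] by linarith
    qed (use \<open>e > 0\<close> in simp)
    then show ?thesis by blast
  qed
  obtain l where l: "l \<in> V" "(\<lambda>n. nrm (\<lambda>x. w n x - l x)) \<longlonglongrightarrow> 0"
    by (rule bexE[OF complete[OF w(1) cauchy]])
  have fd: "\<bar>f (w n) - f l\<bar> \<le> C * nrm (\<lambda>x. w n x - l x)" for n
    using f_bound[OF diff_mem[OF w(1) l(1)]] unfolding f_diff[OF w(1) l(1)] .
  have "(\<lambda>n. C * nrm (\<lambda>x. w n x - l x)) \<longlonglongrightarrow> 0"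
    using tendsto_mult_left[OF l(2), of C] by simp
  then have "(\<lambda>n. f (w n) - f l) \<longlonglongrightarrow> 0"
    by (rule Lim_null_comparison[rotated]) (simp add: fd)
  then have f_lim: "(\<lambda>n. f (w n)) \<longlonglongrightarrow> f l"
    by (rule LIM_zero_cancel)
  have "(\<lambda>n. J (w n)) \<longlonglongrightarrow> J l"
    unfolding J_def
    by (intro tendsto_diff tendsto_mult tendsto_const tendsto_self f_lim l) (simp add: w(1))
  moreover have "(\<lambda>n. m + 1 / real (Suc n)) \<longlonglongrightarrow> m + 0"
    by (intro tendsto_intros LIMSEQ_Suc[OF lim_1_over_n])
  ultimately have "J l \<le> m + 0"
    using w(2) by (intro LIMSEQ_le[of "\<lambda>n. J (w n)" "J l"] exI[of _ 0] allI impI less_imp_le)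
  then have Jl: "J l \<le> m" by simp
  have "B l v = f v" if v: "v \<in> V" for v
  proof -
    \<comment> \<open>J (l + t v) - J l is a quadratic polynomial in t without constant term; being
      nonnegative, it has no linear term either.\<close>
    have "(B l v - f v)\<^sup>2 \<le> 0 * B v v"
    proof (rule nonneg_quadratic_imp[OF nonneg[OF v]])
      fix t
      have "J l \<le> J (\<lambda>x. l x + t *\<^sub>R v x)"
        using Jl m_le[OF add_mem[OF l(1) scale_mem[OF v]], of t] by linarith
      also have "\<dots> = J l + 2 * t * (B l v - f v) + t\<^sup>2 * B v v"
        unfolding J_def using l(1) v
        by (simp only: bilinear f_add f_scale sym[of v l]) (simp add: algebra_simps power2_eq_square)
      finally show "0 \<le> 0 + 2 * t * (B l v - f v) + t\<^sup>2 * B v v" by simp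
    qed
    then show ?thesis by simp
  qed
  then show ?thesis using l(1) by blast
qed

text \<open>
  The sum is the squared Hilbert--Schmidt norm of the projection
  \<open>\<Sum>\<^sub>i x\<^sub>i \<otimes> y\<^sub>i\<close> of rank \<open>|F|\<close>. The induction step makes all but one of the \<open>y\<^sub>i\<close> orthogonal to the
  remaining \<open>y\<^sub>n\<close> without changing this tensor; the new summand is then orthogonal to the others.
\<close>

lemma card_le_sum_biorthogonal:
  assumes "finite F"
    and "\<And>i. i \<in> F \<Longrightarrow> x i \<in> V" "\<And>i. i \<in> F \<Longrightarrow> y i \<in> V"
    and "\<And>i j. i \<in> F \<Longrightarrow> j \<in> F \<Longrightarrow> B (x i) (y j) = (if i = j then 1 else 0)"
  shows "real (card F) \<le> (\<Sum>i\<in>F. \<Sum>j\<in>F. B (x i) (x j) * B (y i) (y j))"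
  using assms
proof (induction F arbitrary: x y rule: finite_induct)
  case (insert n F)
  have xV: "x i \<in> V" "y i \<in> V" if "i \<in> insert n F" for i using insert.prems that by blast+
  have bi: "B (x i) (y j) = (if i = j then 1 else 0)" if "i \<in> insert n F" "j \<in> insert n F" for i j
    using insert.prems that by blast
  have xn: "x n \<in> V" "y n \<in> V" by (simp_all add: xV)
  \<comment> \<open>Coefficient of the projection of y_i onto y_n. That the denominator is nonzero
    follows below from Cauchy-Schwarz, as x_n and y_n pair to 1.\<close>
  define c where "c i = B (y i) (y n) / B (y n) (y n)" for i
  define y' where "y' i = (\<lambda>z. y i z - c i *\<^sub>R y n z)" for i
  \<comment> \<open>Replacing y_i by y'_i moves the part c_i x_i into the factor of y_n: the tensor
    is also the sum of x_i (x) y'_i over F plus (x_n + s) (x) y_n.\<close>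
  define s where "s = (\<lambda>z. \<Sum>i\<in>F. c i *\<^sub>R x i z)"
  have sV: "s \<in> V" unfolding s_def by (intro sum_mem xV) simp
  have y'V: "y' i \<in> V" if "i \<in> F" for i
    unfolding y'_def using that by (intro diff_mem scale_mem xV) auto
  have CS: "1 \<le> B u u * B (y n) (y n)" if "u \<in> V" "B u (y n) = 1" for u
    using Cauchy_Schwarz_power2[OF that(1) xn(2)] that(2) by simp
  have yy0: "B (y n) (y n) \<noteq> 0" using CS[OF xn(1)] bi[of n n] by auto
  have y'yn: "B (y' i) (y n) = 0" if "i \<in> F" for i
    unfolding y'_def using that yy0
    by (simp only: diff_left scale_left scale_mem xV xn insertI2) (simp add: c_def)
  have IH: "real (card F) \<le> (\<Sum>i\<in>F. \<Sum>j\<in>F. B (x i) (x j) * B (y' i) (y' j))"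
  proof (rule insert.IH)
    show "B (x i) (y' j) = (if i = j then 1 else 0)" if "i \<in> F" "j \<in> F" for i j
      unfolding y'_def using that insert.hyps bi[of i n] bi[of i j]
      by (simp only: diff_right scale_right scale_mem xV xn insertI2) auto
  qed (use xV y'V in auto)
  have "B s (y n) = (\<Sum>i\<in>F. c i * B (x i) (y n))"
    unfolding s_def by (intro sum_left xV) simp_all
  also have "\<dots> = 0" using bi insert.hyps by (intro sum.neutral) auto
  \<comment> \<open>x_n + s still pairs to 1 with y_n, so the new summand contributes at least 1 to
    the squared norm; this is the increment of the cardinality.\<close>
  finally have "1 \<le> B (\<lambda>z. x n z + s z) (\<lambda>z. x n z + s z) * B (y n) (y n)"
    using bi[of n n] by (intro CS add_mem xn sV) (simp add: add_left xn sV)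
  also have "\<dots> = (B (x n) (x n) + 2 * B s (x n) + B s s) * B (y n) (y n)"
    by (simp add: bilinear xn sV sym[OF xn(1) sV])
  finally have one: "1 \<le> (B (x n) (x n) + 2 * B s (x n) + B s s) * B (y n) (y n)" .
  have Bs: "B s u = (\<Sum>i\<in>F. c i * B (x i) u)" if "u \<in> V" for u
    unfolding s_def by (intro sum_left xV that) simp
  have sn: "B s (x n) * B (y n) (y n) = (\<Sum>i\<in>F. B (x i) (x n) * B (y i) (y n))"
    unfolding Bs[OF xn(1)] sum_distrib_right using yy0 by (simp add: c_def mult.commute)
  have "B s s = (\<Sum>i\<in>F. c i * (\<Sum>j\<in>F. c j * B (x i) (x j)))"
    unfolding Bs[OF sV] unfolding s_def by (intro sum.cong refl arg_cong2[where f="(*)"] sum_right xV) simp_all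
  then have ss: "B s s * B (y n) (y n) = (\<Sum>i\<in>F. \<Sum>j\<in>F. B (x i) (x j) * (c i * c j * B (y n) (y n)))"
    by (simp add: sum_distrib_left sum_distrib_right mult_ac)
  \<comment> \<open>Pythagoras: each y_i is y'_i plus c_i y_n, and y'_i is orthogonal to
    y_n.\<close>
  have yy: "B (y i) (y j) = B (y' i) (y' j) + c i * c j * B (y n) (y n)" if "i \<in> F" "j \<in> F" for i j
  proof -
    have "B (y' i) (y' j) = B (y' i) (y j)"
      using y'yn[OF that(1)] unfolding y'_def[of j]
      by (simp add: diff_right scale_right scale_mem xV xn that y'V)
    also have "\<dots> = B (y i) (y j) - c i * B (y n) (y j)"
      unfolding y'_def by (simp add: diff_left scale_left scale_mem xV xn that)
    also have "B (y n) (y j) = c j * B (y n) (y n)"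
      using yy0 by (simp add: c_def sym[of "y n" "y j"] xV that)
    finally show ?thesis by simp
  qed
  have "(\<Sum>i\<in>F. \<Sum>j\<in>F. B (x i) (x j) * B (y i) (y j))
      = (\<Sum>i\<in>F. \<Sum>j\<in>F. B (x i) (x j) * B (y' i) (y' j)) + B s s * B (y n) (y n)"
    unfolding ss by (simp add: yy sum.distrib distrib_left)
  moreover have "(\<Sum>j\<in>F. B (x n) (x j) * B (y n) (y j)) = (\<Sum>i\<in>F. B (x i) (x n) * B (y i) (y n))"
    by (intro sum.cong refl) (simp add: sym[of "x n"] sym[of "y n"] xV)
  ultimately show ?case
    using IH one sn insert.hyps by (simp add: sum.distrib algebra_simps)
qed simp

end


section \<open>Square integrable functions\<close>

text \<open>Extends \<open>L2_inner\<close> to vector-valued functions, so that functions and their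
  gradients share one theory.\<close>

definition L2_dot :: "'a::euclidean_space set \<Rightarrow> ('a \<Rightarrow> 'b::euclidean_space) \<Rightarrow> ('a \<Rightarrow> 'b) \<Rightarrow> real" where
  "L2_dot \<Omega> f g = (\<integral>x. f x \<bullet> g x \<partial>(lebesgue_on \<Omega>))"

lemma L2_inner_eq_L2_dot: "L2_inner \<Omega> = L2_dot \<Omega>"
  by (simp add: L2_inner_def L2_dot_def fun_eq_iff)

lemma L2_measurable: "f \<in> L2 \<Omega> \<Longrightarrow> f \<in> borel_measurable (lebesgue_on \<Omega>)"
  by (simp add: L2_def)

lemma L2_integrable_power2: "f \<in> L2 \<Omega> \<Longrightarrow> integrable (lebesgue_on \<Omega>) (\<lambda>x. (norm (f x))\<^sup>2)"
  by (simp add: L2_def)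

lemma L2_norm_nonneg: "0 \<le> L2_norm \<Omega> f"
  by (simp add: L2_norm_def)

lemma L2_integrable_inner:
  fixes f g :: "'a::euclidean_space \<Rightarrow> 'b::euclidean_space"
  assumes "f \<in> L2 \<Omega>" "g \<in> L2 \<Omega>"
  shows "integrable (lebesgue_on \<Omega>) (\<lambda>x. f x \<bullet> g x)"
proof (rule Bochner_Integration.integrable_bound)
  show "integrable (lebesgue_on \<Omega>) (\<lambda>x. (norm (f x))\<^sup>2 + (norm (g x))\<^sup>2)"
    using assms by (intro Bochner_Integration.integrable_add L2_integrable_power2)
  show "(\<lambda>x. f x \<bullet> g x) \<in> borel_measurable (lebesgue_on \<Omega>)"
    using assms by (intro borel_measurable_inner L2_measurable)
  have "\<bar>f x \<bullet> g x\<bar> \<le> (norm (f x))\<^sup>2 + (norm (g x))\<^sup>2" for x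
  proof -
    have "\<bar>f x \<bullet> g x\<bar> \<le> norm (f x) * norm (g x)" by (rule Cauchy_Schwarz_ineq2)
    also have "\<dots> \<le> (norm (f x))\<^sup>2 + (norm (g x))\<^sup>2"
      using sum_squares_bound[of "norm (f x)" "norm (g x)"]
        mult_nonneg_nonneg[OF norm_ge_zero norm_ge_zero, of "f x" "g x"] by linarith
    finally show ?thesis .
  qed
  then show "AE x in lebesgue_on \<Omega>. norm (f x \<bullet> g x) \<le> norm ((norm (f x))\<^sup>2 + (norm (g x))\<^sup>2)"
    by simp
qed

interpretation L2: semi_inner "L2 \<Omega>" "L2_dot \<Omega>"
  rewrites nrm_L2_dot: "semi_inner.nrm (L2_dot \<Omega>) = L2_norm \<Omega>"
  for \<Omega> :: "'a::euclidean_space set"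
proof -
  show *: "semi_inner (L2 \<Omega>) (L2_dot \<Omega> :: ('a \<Rightarrow> 'b::euclidean_space) \<Rightarrow> _)"
  proof
    fix u v w :: "'a \<Rightarrow> 'b" and c
    show "(\<lambda>x. 0 :: 'b) \<in> L2 \<Omega>" by (simp add: L2_def)
    show "(\<lambda>x. c *\<^sub>R u x) \<in> L2 \<Omega>" if "u \<in> L2 \<Omega>"
      using that by (auto simp: L2_def power_mult_distrib intro!: borel_measurable_scaleR)
    show "(\<lambda>x. u x + v x) \<in> L2 \<Omega>" if u: "u \<in> L2 \<Omega>" and v: "v \<in> L2 \<Omega>"
    proof -
      have "integrable (lebesgue_on \<Omega>) (\<lambda>x. (u x \<bullet> u x + v x \<bullet> v x) + 2 * (u x \<bullet> v x))"
        using u v by (intro Bochner_Integration.integrable_add integrable_mult_right L2_integrable_inner)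
      then show ?thesis
        using u v by (auto simp: L2_def power2_norm_eq_inner inner_add inner_commute algebra_simps
          intro!: borel_measurable_add)
    qed
    show "L2_dot \<Omega> u v = L2_dot \<Omega> v u" by (simp add: L2_dot_def inner_commute)
    show "L2_dot \<Omega> (\<lambda>x. u x + v x) w = L2_dot \<Omega> u w + L2_dot \<Omega> v w"
      if "u \<in> L2 \<Omega>" "v \<in> L2 \<Omega>" "w \<in> L2 \<Omega>"
      using that by (simp add: L2_dot_def inner_add_left L2_integrable_inner)
    show "L2_dot \<Omega> (\<lambda>x. c *\<^sub>R u x) v = c * L2_dot \<Omega> u v"
      by (simp add: L2_dot_def)
    show "0 \<le> L2_dot \<Omega> u u" by (simp add: L2_dot_def)
  qed
  show "semi_inner.nrm (L2_dot \<Omega> :: ('a \<Rightarrow> 'b::euclidean_space) \<Rightarrow> _) = L2_norm \<Omega>"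
    by (simp add: fun_eq_iff semi_inner.nrm_def[OF *] L2_norm_def L2_dot_def power2_norm_eq_inner)
qed

lemma L2_norm_AE_cong:
  assumes "f \<in> borel_measurable (lebesgue_on \<Omega>)" "g \<in> borel_measurable (lebesgue_on \<Omega>)"
    "AE x in lebesgue_on \<Omega>. f x = g x"
  shows "L2_norm \<Omega> f = L2_norm \<Omega> g"
  unfolding L2_norm_def by (intro arg_cong[where f=sqrt] integral_cong_AE) (use assms in auto)

lemma L2_dot_AE_cong:
  assumes "f \<in> L2 \<Omega>" "f' \<in> L2 \<Omega>" "g \<in> L2 \<Omega>" "g' \<in> L2 \<Omega>"
    "AE x in lebesgue_on \<Omega>. f x = f' x" "AE x in lebesgue_on \<Omega>. g x = g' x"
  shows "L2_dot \<Omega> f g = L2_dot \<Omega> f' g'"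
  unfolding L2_dot_def
  by (intro integral_cong_AE borel_measurable_inner L2_measurable) (use assms in auto)

lemma L2_norm_AE_0: "AE x in lebesgue_on \<Omega>. f x = 0 \<Longrightarrow> L2_norm \<Omega> f = 0"
  unfolding L2_norm_def by (subst integral_eq_zero_AE) auto

lemma L2_mono:
  fixes f :: "'a::euclidean_space \<Rightarrow> 'b::euclidean_space" and g :: "'a \<Rightarrow> 'c::euclidean_space"
  assumes "g \<in> L2 \<Omega>" "f \<in> borel_measurable (lebesgue_on \<Omega>)" "\<And>x. norm (f x) \<le> norm (g x)"
  shows "f \<in> L2 \<Omega>"
proof -
  have "integrable (lebesgue_on \<Omega>) (\<lambda>x. (norm (f x))\<^sup>2)"
    by (rule Bochner_Integration.integrable_bound[OF L2_integrable_power2[OF assms(1)]])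
      (use assms in \<open>auto intro!: power_mono\<close>)
  then show ?thesis using assms(2) by (simp add: L2_def)
qed

lemma L2_norm_mono:
  fixes f :: "'a::euclidean_space \<Rightarrow> 'b::euclidean_space" and g :: "'a \<Rightarrow> 'c::euclidean_space"
  assumes "g \<in> L2 \<Omega>" "f \<in> borel_measurable (lebesgue_on \<Omega>)" "\<And>x. norm (f x) \<le> norm (g x)"
  shows "L2_norm \<Omega> f \<le> L2_norm \<Omega> g"
  unfolding L2_norm_def
  using L2_mono[OF assms] assms
  by (intro real_sqrt_le_mono integral_mono L2_integrable_power2 power_mono) auto

lemma L2_norm_norm: "L2_norm \<Omega> (\<lambda>x. norm (f x)) = L2_norm \<Omega> f"
  by (simp add: L2_norm_def)

lemma const_in_L2:
  assumes "\<Omega> \<in> lmeasurable"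
  shows "(\<lambda>x. c) \<in> L2 \<Omega>"
proof -
  interpret finite_measure "lebesgue_on \<Omega>" using assms by (rule finite_measure_lebesgue_on)
  show ?thesis by (simp add: L2_def)
qed

lemma L2_imp_integrable:
  fixes f :: "'a::euclidean_space \<Rightarrow> 'b::euclidean_space"
  assumes "\<Omega> \<in> lmeasurable" "f \<in> L2 \<Omega>"
  shows "integrable (lebesgue_on \<Omega>) f"
proof (rule Bochner_Integration.integrable_bound)
  have "(\<lambda>x. norm (f x)) \<in> L2 \<Omega>"
    using L2_measurable[OF assms(2)] by (intro L2_mono[OF assms(2)]) auto
  then show "integrable (lebesgue_on \<Omega>) (\<lambda>x. norm (f x) \<bullet> 1)"
    by (intro L2_integrable_inner const_in_L2 assms)
qed (use L2_measurable[OF assms(2)] in auto)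

text \<open>Cauchy-Schwarz against the constant 1, which is square integrable since \<Omega> has
  finite measure.\<close>

lemma L1_le_L2:
  fixes f :: "'a::euclidean_space \<Rightarrow> 'b::euclidean_space"
  assumes "\<Omega> \<in> lmeasurable" "f \<in> L2 \<Omega>"
  shows "(\<integral>x. norm (f x) \<partial>(lebesgue_on \<Omega>)) \<le> L2_norm \<Omega> f * L2_norm \<Omega> (\<lambda>x. 1 :: real)"
proof -
  have "(\<lambda>x. norm (f x)) \<in> L2 \<Omega>"
    using L2_measurable[OF assms(2)] by (intro L2_mono[OF assms(2)]) auto
  from L2.Cauchy_Schwarz[OF this const_in_L2[OF assms(1)], of 1] show ?thesis
    by (simp add: L2_dot_def L2_norm_norm)
qed

text \<open>On a set of finite measure a Cauchy sequence in L2 is Cauchy in L1, hence has a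
  subsequence converging almost everywhere. Fatou's lemma turns the pointwise limit into an L2 limit
  of the whole sequence.\<close>

lemma L2_complete:
  fixes w :: "nat \<Rightarrow> 'a::euclidean_space \<Rightarrow> 'b::euclidean_space"
  assumes \<Omega>: "\<Omega> \<in> lmeasurable" and w: "\<And>n. w n \<in> L2 \<Omega>"
    and cauchy: "\<And>e. e > 0 \<Longrightarrow> \<exists>N. \<forall>m\<ge>N. \<forall>n\<ge>N. L2_norm \<Omega> (\<lambda>x. w m x - w n x) < e"
  shows "\<exists>l\<in>L2 \<Omega>. (\<lambda>n. L2_norm \<Omega> (\<lambda>x. w n x - l x)) \<longlonglongrightarrow> 0"
proof -
  define M where "M = lebesgue_on \<Omega>"
  define K where "K = L2_norm \<Omega> (\<lambda>x. 1 :: real)"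
  have "K \<ge> 0" by (simp add: K_def L2_norm_nonneg)
  have [measurable]: "w n \<in> borel_measurable M" for n
    unfolding M_def by (rule L2_measurable[OF w])
  have "\<exists>N. \<forall>i\<ge>N. \<forall>j\<ge>N. LINT x|M. norm (w i x - w j x) < e" if "e > 0" for e
  proof -
    \<comment> \<open>K + 1 instead of K, because K is 0 if \<Omega> is a null set.\<close>
    obtain N where N: "\<And>i j. i \<ge> N \<Longrightarrow> j \<ge> N \<Longrightarrow> L2_norm \<Omega> (\<lambda>x. w i x - w j x) < e / (K + 1)"
      using cauchy[of "e / (K + 1)"] \<open>e > 0\<close> \<open>K \<ge> 0\<close> by auto
    have "LINT x|M. norm (w i x - w j x) < e" if "i \<ge> N" "j \<ge> N" for i j
    proof -
      have "LINT x|M. norm (w i x - w j x) \<le> L2_norm \<Omega> (\<lambda>x. w i x - w j x) * K"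
        unfolding M_def K_def by (intro L1_le_L2 \<Omega> L2.diff_mem w)
      also have "\<dots> \<le> e / (K + 1) * K"
        using N[OF that] \<open>K \<ge> 0\<close> by (intro mult_right_mono) auto
      also have "\<dots> < e" using \<open>e > 0\<close> \<open>K \<ge> 0\<close> by (simp add: field_simps)
      finally show ?thesis .
    qed
    then show ?thesis by blast
  qed
  then obtain r where r: "strict_mono r" "AE x in M. Cauchy (\<lambda>i. w (r i) x)"
    using cauchy_L1_AE_cauchy_subseq[of M w] L2_imp_integrable[OF \<Omega> w] unfolding M_def by blast
  define l where "l x = lim (\<lambda>i. w (r i) x)" for x
  have [measurable]: "l \<in> borel_measurable M"
    unfolding l_def by (rule borel_measurable_lim_metric) measurable
  have lim: "AE x in M. (\<lambda>i. w (r i) x) \<longlonglongrightarrow> l x"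
    using r(2) by eventually_elim (simp add: l_def Cauchy_convergent_iff convergent_LIMSEQ_iff)
  \<comment> \<open>The index m stays fixed and only the second index runs along the subsequence, so
    the bound holds for every m that satisfies the premise and not just along r.\<close>
  have fatou: "(\<lambda>x. w m x - l x) \<in> L2 \<Omega> \<and> L2_norm \<Omega> (\<lambda>x. w m x - l x) \<le> e"
    if N: "\<And>i. i \<ge> N \<Longrightarrow> L2_norm \<Omega> (\<lambda>x. w m x - w i x) < e" for e m N
  proof -
    have e: "e > 0" using le_less_trans[OF L2_norm_nonneg N[of N]] by simp
    have "(\<integral>\<^sup>+x. ennreal ((norm (w m x - l x))\<^sup>2) \<partial>M)
        = (\<integral>\<^sup>+x. liminf (\<lambda>i. ennreal ((norm (w m x - w (r i) x))\<^sup>2)) \<partial>M)"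
    proof (rule nn_integral_cong_AE, use lim in eventually_elim)
      case (elim x)
      have "(\<lambda>i. ennreal ((norm (w m x - w (r i) x))\<^sup>2)) \<longlonglongrightarrow> ennreal ((norm (w m x - l x))\<^sup>2)"
        by (intro tendsto_intros elim)
      then show ?case by (rule lim_imp_Liminf[OF sequentially_bot, symmetric])
    qed
    also have "\<dots> \<le> liminf (\<lambda>i. \<integral>\<^sup>+x. ennreal ((norm (w m x - w (r i) x))\<^sup>2) \<partial>M)"
      by (rule nn_integral_liminf) measurable
    also have "\<dots> \<le> ennreal (e\<^sup>2)"
    proof (rule Liminf_le)
      show "\<forall>\<^sub>F i in sequentially. (\<integral>\<^sup>+x. ennreal ((norm (w m x - w (r i) x))\<^sup>2) \<partial>M) \<le> ennreal (e\<^sup>2)"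
        using eventually_ge_at_top[of N]
      proof eventually_elim
        case (elim i)
        have mem: "(\<lambda>x. w m x - w (r i) x) \<in> L2 \<Omega>" by (intro L2.diff_mem w)
        have "(\<integral>\<^sup>+x. ennreal ((norm (w m x - w (r i) x))\<^sup>2) \<partial>M)
            = ennreal (LINT x|M. (norm (w m x - w (r i) x))\<^sup>2)"
          unfolding M_def by (intro nn_integral_eq_integral L2_integrable_power2 mem) simp
        also have "(LINT x|M. (norm (w m x - w (r i) x))\<^sup>2) = (L2_norm \<Omega> (\<lambda>x. w m x - w (r i) x))\<^sup>2"
          by (simp add: L2_norm_def M_def)
        also have "\<dots> \<le> e\<^sup>2"
          using N[of "r i"] elim seq_suble[OF r(1), of i] by (intro power_mono L2_norm_nonneg) auto
        finally show ?case by (simp add: ennreal_leI)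
      qed
    qed simp
    finally have le: "(\<integral>\<^sup>+x. ennreal ((norm (w m x - l x))\<^sup>2) \<partial>M) \<le> ennreal (e\<^sup>2)" .
    have int: "integrable M (\<lambda>x. (norm (w m x - l x))\<^sup>2)"
      by (rule integrableI_bounded) (use le in \<open>auto simp: less_top[symmetric] top_unique\<close>)
    then have "ennreal (LINT x|M. (norm (w m x - l x))\<^sup>2) \<le> ennreal (e\<^sup>2)"
      using le by (simp add: nn_integral_eq_integral)
    then have "(LINT x|M. (norm (w m x - l x))\<^sup>2) \<le> e\<^sup>2" by simp
    then have "L2_norm \<Omega> (\<lambda>x. w m x - l x) \<le> e"
      using e unfolding L2_norm_def M_def by (intro real_le_lsqrt) auto
    moreover have "(\<lambda>x. w m x - l x) \<in> L2 \<Omega>"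
      using int unfolding L2_def M_def[symmetric] by simp
    ultimately show ?thesis by blast
  qed
  obtain N1 where N1: "\<forall>m\<ge>N1. \<forall>n\<ge>N1. L2_norm \<Omega> (\<lambda>x. w m x - w n x) < 1"
    using cauchy[of 1] by auto
  have "(\<lambda>x. w N1 x - l x) \<in> L2 \<Omega>" using fatou[of N1 N1 1] N1 by simp
  \<comment> \<open>l is w N1 minus the square integrable difference w N1 - l.\<close>
  from L2.diff_mem[OF w[of N1] this] have lL2: "l \<in> L2 \<Omega>" by simp
  moreover have "(\<lambda>n. L2_norm \<Omega> (\<lambda>x. w n x - l x)) \<longlonglongrightarrow> 0"
  proof (rule LIMSEQ_I)
    fix e :: real assume "e > 0"
    then obtain N where N: "\<forall>m\<ge>N. \<forall>n\<ge>N. L2_norm \<Omega> (\<lambda>x. w m x - w n x) < e / 2"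
      using cauchy[of "e / 2"] by auto
    have "norm (L2_norm \<Omega> (\<lambda>x. w m x - l x) - 0) < e" if "m \<ge> N" for m
      using fatou[of N m "e / 2"] N that \<open>e > 0\<close> by (auto simp: L2_norm_nonneg)
    then show "\<exists>N. \<forall>m\<ge>N. norm (L2_norm \<Omega> (\<lambda>x. w m x - l x) - 0) < e" by blast
  qed
  ultimately show ?thesis by blast
qed


section \<open>Smooth functions and test functions\<close>

definition smooth :: "('a::euclidean_space \<Rightarrow> real) \<Rightarrow> bool" where
  "smooth f \<longleftrightarrow> (\<forall>k. Ck k f)"

lemma partial_deriv_eq: "(f has_derivative f') (at x) \<Longrightarrow> partial_deriv b f x = f' b"
  unfolding partial_deriv_def using frechet_derivative_at by metis

text \<open>\<open>Ck\<close> refers to the derivative selected by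
  \<open>frechet_derivative\<close>; this rule and \<open>Ck_SucE\<close> allow any explicit
  derivative in its place.\<close>

lemma Ck_SucI:
  assumes "\<And>x. (f has_derivative f' x) (at x)" "\<And>b. b \<in> Basis \<Longrightarrow> Ck k (\<lambda>x. f' x b)"
  shows "Ck (Suc k) f"
proof -
  have "partial_deriv b f = (\<lambda>x. f' x b)" for b
    using partial_deriv_eq[OF assms(1)] by (simp add: fun_eq_iff)
  then show ?thesis using assms by (auto simp: differentiable_def)
qed

lemma Ck_SucE:
  assumes "Ck (Suc k) f"
  obtains f' where "\<And>x. (f has_derivative f' x) (at x)" "\<And>b. b \<in> Basis \<Longrightarrow> Ck k (\<lambda>x. f' x b)"
proof
  show "(f has_derivative frechet_derivative f (at x)) (at x)" for x
    using assms by (auto simp: frechet_derivative_works[symmetric])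
  show "Ck k (\<lambda>x. frechet_derivative f (at x) b)" if "b \<in> Basis" for b
    using assms that by (auto simp: partial_deriv_def[abs_def])
qed

lemma Ck_Suc_imp: "Ck (Suc k) f \<Longrightarrow> Ck k f"
proof (induction k arbitrary: f)
  case 0
  then show ?case
    by (auto intro!: differentiable_imp_continuous_on simp: differentiable_on_def)
next
  case (Suc k)
  then show ?case by (auto simp: Ck.simps(2)[of "Suc k"] Ck.simps(2)[of k])
qed

lemma Ck_imp_continuous_on: "Ck k f \<Longrightarrow> continuous_on UNIV f"
  by (induction k) (use Ck_Suc_imp in auto)

lemma Ck_const: "Ck k (\<lambda>x. c)"
  by (induction k arbitrary: c) (auto intro!: Ck_SucI[where f'="\<lambda>_ _. 0"] simp del: Ck.simps(2))

lemma Ck_add: "Ck k f \<Longrightarrow> Ck k g \<Longrightarrow> Ck k (\<lambda>x. f x + g x)"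
proof (induction k arbitrary: f g)
  case 0
  then show ?case by (auto intro: continuous_intros)
next
  case (Suc k)
  obtain f' where f': "\<And>x. (f has_derivative f' x) (at x)" "\<And>b. b \<in> Basis \<Longrightarrow> Ck k (\<lambda>x. f' x b)"
    using Ck_SucE[OF Suc.prems(1)] by blast
  obtain g' where g': "\<And>x. (g has_derivative g' x) (at x)" "\<And>b. b \<in> Basis \<Longrightarrow> Ck k (\<lambda>x. g' x b)"
    using Ck_SucE[OF Suc.prems(2)] by blast
  show ?case
    by (rule Ck_SucI[OF has_derivative_add[OF f'(1) g'(1)]]) (rule Suc.IH[OF f'(2) g'(2)])
qed

lemma Ck_mult: "Ck k f \<Longrightarrow> Ck k g \<Longrightarrow> Ck k (\<lambda>x. f x * g x)"
proof (induction k arbitrary: f g)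
  case 0
  then show ?case by (auto intro: continuous_intros)
next
  case (Suc k)
  obtain f' where f': "\<And>x. (f has_derivative f' x) (at x)" "\<And>b. b \<in> Basis \<Longrightarrow> Ck k (\<lambda>x. f' x b)"
    using Ck_SucE[OF Suc.prems(1)] by blast
  obtain g' where g': "\<And>x. (g has_derivative g' x) (at x)" "\<And>b. b \<in> Basis \<Longrightarrow> Ck k (\<lambda>x. g' x b)"
    using Ck_SucE[OF Suc.prems(2)] by blast
  show ?case
    by (rule Ck_SucI[OF has_derivative_mult[OF f'(1) g'(1)]])
      (rule Ck_add[OF Suc.IH[OF Ck_Suc_imp[OF Suc.prems(1)] g'(2)]
          Suc.IH[OF f'(2) Ck_Suc_imp[OF Suc.prems(2)]]])
qed

lemma smooth_const: "smooth (\<lambda>x. c)"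
  by (simp add: smooth_def Ck_const)

lemma smooth_add: "smooth f \<Longrightarrow> smooth g \<Longrightarrow> smooth (\<lambda>x. f x + g x)"
  by (simp add: smooth_def Ck_add)

lemma smooth_mult: "smooth f \<Longrightarrow> smooth g \<Longrightarrow> smooth (\<lambda>x. f x * g x)"
  by (simp add: smooth_def Ck_mult)

lemma smooth_prod: "(\<And>i. i \<in> F \<Longrightarrow> smooth (f i)) \<Longrightarrow> smooth (\<lambda>x. \<Prod>i\<in>F. f i x)"
  by (induction F rule: infinite_finite_induct) (auto intro: smooth_const smooth_mult)

lemma smooth_partial_deriv: "smooth f \<Longrightarrow> b \<in> Basis \<Longrightarrow> smooth (partial_deriv b f)"
  unfolding smooth_def by (metis Ck.simps(2))

lemma smooth_has_derivative:
  assumes "smooth f"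
  shows "(f has_derivative frechet_derivative f (at x)) (at x)"
  using assms frechet_derivative_works unfolding smooth_def by (metis Ck.simps(2))

lemma smooth_continuous_on: "smooth f \<Longrightarrow> continuous_on S f"
  using Ck_imp_continuous_on continuous_on_subset unfolding smooth_def by blast

lemma smooth_inner: "smooth (\<lambda>x. x \<bullet> v)"
proof -
  have "Ck k (\<lambda>x. x \<bullet> v)" for k
  proof (cases k)
    case 0
    then show ?thesis by (auto intro!: continuous_intros)
  next
    case (Suc j)
    show ?thesis unfolding Suc
      by (rule Ck_SucI[OF bounded_linear.has_derivative[OF bounded_linear_inner_left has_derivative_ident]])
        (rule Ck_const)
  qed
  then show ?thesis by (simp add: smooth_def)
qed

text \<open>The derivative contains \<open>exp (f x)\<close> again, and the induction hypothesis
  supplies this factor at the lower order. Needed for the cut-offs 1 - exp (c \<phi>).\<close>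

lemma smooth_exp:
  assumes "smooth f"
  shows "smooth (\<lambda>x. exp (f x))"
proof -
  have "Ck k (\<lambda>x. exp (f x))" for k
  proof (induction k)
    case 0
    show ?case using smooth_continuous_on[OF assms] by (auto intro: continuous_intros)
  next
    case (Suc k)
    have "((\<lambda>x. exp (f x)) has_derivative (\<lambda>h. exp (f x) * frechet_derivative f (at x) h)) (at x)" for x
      using has_derivative_exp[OF smooth_has_derivative[OF assms]] by (simp add: mult.commute)
    then show ?case
      by (rule Ck_SucI) (use Ck_mult[OF Suc] smooth_partial_deriv[OF assms]
          in \<open>simp add: smooth_def partial_deriv_def[abs_def]\<close>)
  qed
  then show ?thesis by (simp add: smooth_def)
qed

text \<open>
  The functions \<open>t \<mapsto> p(1/t) exp(-1/t)\<close>, extended by \<open>0\<close> to \<open>t \<le> 0\<close>, with \<open>p\<close> a polynomial, form a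
  class closed under differentiation.
\<close>

definition flat_fun :: "real poly \<Rightarrow> real \<Rightarrow> real" where
  "flat_fun p t = (if 0 < t then poly p (1 / t) * exp (- (1 / t)) else 0)"

lemma poly_times_exp_tendsto_0: "((\<lambda>s. poly p s * exp (- s)) \<longlongrightarrow> 0) (at_top :: real filter)"
proof -
  have "((\<lambda>s. \<Sum>i\<le>degree p. coeff p i * (s ^ i / exp s)) \<longlongrightarrow> (\<Sum>i\<le>degree p. coeff p i * 0)) at_top"
    by (intro tendsto_sum tendsto_mult tendsto_const tendsto_power_div_exp_0)
  then show ?thesis
    by (simp add: poly_altdef sum_divide_distrib exp_minus field_simps)
qed

text \<open>With s = 1/t, the chain rule gives s^2 (p(s) - p'(s)) exp(-s); the polynomial
  \<open>[:0, 0, 1:]\<close> is s^2. At t = 0 both one-sided difference quotients tend to 0.\<close>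

lemma flat_fun_has_derivative:
  "(flat_fun p has_real_derivative flat_fun ([:0, 0, 1:] * (p - pderiv p)) t) (at t)"
proof -
  consider "t < 0" | "t > 0" | "t = 0" by linarith
  then show ?thesis
  proof cases
    case 1
    have "((\<lambda>_. 0) has_real_derivative 0) (at t)" by simp
    then have "(flat_fun p has_real_derivative 0) (at t)"
      by (rule has_field_derivative_transform_within_open[of _ _ _ "{..<0}"])
        (use 1 in \<open>auto simp: flat_fun_def\<close>)
    then show ?thesis using 1 by (simp add: flat_fun_def)
  next
    case 2
    have "((\<lambda>t. poly p (1 / t) * exp (- (1 / t))) has_real_derivative
        poly ([:0, 0, 1:] * (p - pderiv p)) (1 / t) * exp (- (1 / t))) (at t)"
      using 2 by (auto intro!: derivative_eq_intros simp: field_simps power2_eq_square)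
    then have "(flat_fun p has_real_derivative
        poly ([:0, 0, 1:] * (p - pderiv p)) (1 / t) * exp (- (1 / t))) (at t)"
      by (rule has_field_derivative_transform_within_open[of _ _ _ "{0<..}"])
        (use 2 in \<open>auto simp: flat_fun_def\<close>)
    then show ?thesis using 2 by (simp add: flat_fun_def)
  next
    case 3
    have "((\<lambda>h. flat_fun p h / h) \<longlongrightarrow> 0) (at_left 0)"
      by (rule tendsto_eventually) (auto simp: eventually_at_filter flat_fun_def)
    moreover have "((\<lambda>h. flat_fun p h / h) \<longlongrightarrow> 0) (at_right 0)"
    proof (rule Lim_transform_eventually)
      \<comment> \<open>\<open>pCons 0 p\<close> is s p(s): the extra factor s = 1/h is the division
        by h in the difference quotient.\<close>
      show "((\<lambda>h. poly (pCons 0 p) (inverse h) * exp (- inverse h)) \<longlongrightarrow> 0) (at_right (0::real))"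
        by (rule filterlim_compose[OF poly_times_exp_tendsto_0 filterlim_inverse_at_top_right])
      show "\<forall>\<^sub>F h in at_right 0. poly (pCons 0 p) (inverse h) * exp (- inverse h) = flat_fun p h / h"
        by (auto simp: eventually_at_filter flat_fun_def field_simps)
    qed
    ultimately have "((\<lambda>h. flat_fun p h / h) \<longlongrightarrow> 0) (at 0)"
      by (rule filterlim_split_at)
    then show ?thesis using 3 by (simp add: DERIV_def flat_fun_def)
  qed
qed

lemma smooth_flat_fun: "smooth (\<lambda>x. flat_fun p (x \<bullet> v + c))"
proof -
  have "Ck k (\<lambda>x. flat_fun p (x \<bullet> v + c))" for k
  \<comment> \<open>Differentiation changes the polynomial, so p has to vary in the
    induction.\<close>
  proof (induction k arbitrary: p)
    case 0
    have "continuous_on UNIV (flat_fun p)"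
      by (rule DERIV_continuous_on[OF has_field_derivative_at_within[OF flat_fun_has_derivative]])
    then show ?case
      by (auto intro!: continuous_on_compose2[of UNIV "flat_fun p"] continuous_intros)
  next
    case (Suc k)
    have "((\<lambda>x. flat_fun p (x \<bullet> v + c)) has_derivative
        (\<lambda>h. flat_fun ([:0, 0, 1:] * (p - pderiv p)) (x \<bullet> v + c) * (h \<bullet> v))) (at x)" for x
    proof -
      have "((\<lambda>x. x \<bullet> v + c) has_derivative (\<lambda>h. h \<bullet> v)) (at x)"
        by (auto intro!: derivative_eq_intros)
      from has_derivative_compose[OF this flat_fun_has_derivative[unfolded has_field_derivative_def]]
      show ?thesis .
    qed
    then show ?case
      by (rule Ck_SucI) (rule Ck_mult[OF Suc.IH Ck_const])
  qed
  then show ?thesis by (simp add: smooth_def)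
qed

section \<open>Operations on test functions and bump functions on boxes\<close>

lemma test_functions_iff:
  "\<phi> \<in> test_functions \<Omega> \<longleftrightarrow> smooth \<phi> \<and> (\<exists>K. compact K \<and> K \<subseteq> \<Omega> \<and> (\<forall>x. x \<notin> K \<longrightarrow> \<phi> x = 0))"
  by (auto simp: test_functions_def smooth_def)

lemma test_functions_smooth: "\<phi> \<in> test_functions \<Omega> \<Longrightarrow> smooth \<phi>"
  by (simp add: test_functions_iff)

lemma test_functions_zero: "(\<lambda>x. 0) \<in> test_functions \<Omega>"
  by (auto simp: test_functions_iff smooth_const intro: exI[of _ "{}"])

lemma test_functions_add:
  assumes "\<phi> \<in> test_functions \<Omega>" "\<psi> \<in> test_functions \<Omega>"
  shows "(\<lambda>x. \<phi> x + \<psi> x) \<in> test_functions \<Omega>"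
proof -
  from assms obtain K L where "compact K" "K \<subseteq> \<Omega>" "\<forall>x. x \<notin> K \<longrightarrow> \<phi> x = 0"
    "compact L" "L \<subseteq> \<Omega>" "\<forall>x. x \<notin> L \<longrightarrow> \<psi> x = 0"
    by (auto simp: test_functions_iff)
  then have "compact (K \<union> L) \<and> K \<union> L \<subseteq> \<Omega> \<and> (\<forall>x. x \<notin> K \<union> L \<longrightarrow> \<phi> x + \<psi> x = 0)"
    by (auto intro: compact_Un)
  then show ?thesis
    using assms unfolding test_functions_iff by (blast intro: smooth_add)
qed

lemma test_functions_mult:
  assumes "\<phi> \<in> test_functions \<Omega>" "smooth f"
  shows "(\<lambda>x. f x * \<phi> x) \<in> test_functions \<Omega>"
  using assms unfolding test_functions_iff by (auto intro: smooth_mult) 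

lemma test_functions_sum:
  "(\<And>i. i \<in> F \<Longrightarrow> \<phi> i \<in> test_functions \<Omega>) \<Longrightarrow> (\<lambda>x. \<Sum>i\<in>F. \<phi> i x) \<in> test_functions \<Omega>"
  by (induction F rule: infinite_finite_induct)
    (auto intro: test_functions_zero test_functions_add)

text \<open>Since exp 0 = 1, the new function vanishes wherever \<phi> does and inherits its compact
  set K.\<close>

lemma test_functions_one_minus_exp:
  assumes "\<phi> \<in> test_functions \<Omega>"
  shows "(\<lambda>x. 1 - exp (c * \<phi> x)) \<in> test_functions \<Omega>"
proof -
  have "smooth (\<lambda>x. 1 + (-1) * exp (c * \<phi> x))"
    using test_functions_smooth[OF assms]
    by (intro smooth_add smooth_mult smooth_const smooth_exp)
  then show ?thesis using assms by (auto simp: test_functions_iff)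
qed

lemma test_functions_partial_deriv:
  assumes "\<phi> \<in> test_functions \<Omega>" "b \<in> Basis"
  shows "partial_deriv b \<phi> \<in> test_functions \<Omega>"
proof -
  from assms obtain K where K: "compact K" "K \<subseteq> \<Omega>" "\<And>x. x \<notin> K \<Longrightarrow> \<phi> x = 0"
    by (auto simp: test_functions_iff)
  have "partial_deriv b \<phi> x = 0" if "x \<notin> K" for x
  proof -
    have "(\<phi> has_derivative (\<lambda>_. 0)) (at x)"
      by (rule has_derivative_transform_within_open[OF has_derivative_const[of 0], of "- K"])
        (use K that in \<open>auto simp: compact_imp_closed open_Compl\<close>)
    then show ?thesis by (rule partial_deriv_eq)
  qed
  then show ?thesis
    using K smooth_partial_deriv[OF test_functions_smooth[OF assms(1)] assms(2)]
    unfolding test_functions_iff by blast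
qed

text \<open>A product over the coordinates of exp(-1/(x_i - a_i)) exp(-1/(b_i - x_i)), extended by
  0. It is supported in the closed box, which therefore has to lie in \<Omega>.\<close>

lemma obtain_box_bump:
  fixes a b :: "'a::euclidean_space"
  assumes "cbox a b \<subseteq> \<Omega>"
  obtains \<phi> where "\<phi> \<in> test_functions \<Omega>" "\<And>x. 0 \<le> \<phi> x" "\<And>x. 0 < \<phi> x \<longleftrightarrow> x \<in> box a b"
proof
  define \<phi> where "\<phi> x = (\<Prod>i\<in>Basis. flat_fun 1 (x \<bullet> i + - (a \<bullet> i)) * flat_fun 1 (x \<bullet> - i + b \<bullet> i))"
    for x :: 'a
  have pos: "0 < \<phi> x" if "x \<in> box a b" for x
    unfolding \<phi>_def using that by (intro prod_pos) (auto simp: flat_fun_def mem_box)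
  have zero: "\<phi> x = 0" if "x \<notin> box a b" for x
  proof -
    from that obtain i where i: "i \<in> Basis" "x \<bullet> i \<le> a \<bullet> i \<or> b \<bullet> i \<le> x \<bullet> i"
      by (auto simp: mem_box not_less)
    then have "flat_fun 1 (x \<bullet> i + - (a \<bullet> i)) * flat_fun 1 (x \<bullet> - i + b \<bullet> i) = 0"
      by (auto simp: flat_fun_def)
    then show ?thesis unfolding \<phi>_def using i(1) by (intro prod_zero) auto
  qed
  show "0 < \<phi> x \<longleftrightarrow> x \<in> box a b" for x using pos zero[of x] by force
  show "0 \<le> \<phi> x" for x using pos[of x] zero[of x] by force
  have "smooth \<phi>" unfolding \<phi>_def by (intro smooth_prod smooth_mult smooth_flat_fun)
  then show "\<phi> \<in> test_functions \<Omega>"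
    unfolding test_functions_iff
    using assms zero box_subset_cbox[of a b] by (intro conjI exI[of _ "cbox a b"]) auto
qed

lemma smooth_borel_measurable: "smooth f \<Longrightarrow> f \<in> borel_measurable borel"
  by (intro borel_measurable_continuous_onI smooth_continuous_on)

lemma borel_imp_lebesgue_on_measurable:
  "f \<in> borel_measurable borel \<Longrightarrow> f \<in> borel_measurable (lebesgue_on \<Omega>)"
  by (intro measurable_restrict_space1 measurable_completion) simp

text \<open>Passes from \<Omega> to the whole space, where translation invariance of the measure is
  available.\<close>

lemma integral_lebesgue_on_eq_lborel:
  fixes f :: "'a::euclidean_space \<Rightarrow> real"
  assumes "open \<Omega>" "f \<in> borel_measurable borel" "\<And>x. x \<notin> \<Omega> \<Longrightarrow> f x = 0"
  shows "(\<integral>x. f x \<partial>(lebesgue_on \<Omega>)) = (\<integral>x. f x \<partial>lborel)"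
proof -
  have "(\<integral>x. f x \<partial>(lebesgue_on \<Omega>)) = (\<integral>x. (if x \<in> \<Omega> then f x else 0) \<partial>lebesgue)"
    using assms(1) by (intro Lebesgue_Measure.integral_restrict_UNIV[symmetric]) auto
  also have "(\<lambda>x. if x \<in> \<Omega> then f x else 0) = f" using assms(3) by auto
  also have "(\<integral>x. f x \<partial>lebesgue) = (\<integral>x. f x \<partial>lborel)"
    using assms(2) by (intro integral_completion) simp
  finally show ?thesis .
qed

lemma test_functions_vanish: "\<phi> \<in> test_functions \<Omega> \<Longrightarrow> x \<notin> \<Omega> \<Longrightarrow> \<phi> x = 0"
  by (auto simp: test_functions_iff)

lemma test_functions_borel: "\<phi> \<in> test_functions \<Omega> \<Longrightarrow> \<phi> \<in> borel_measurable borel"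
  by (intro smooth_borel_measurable test_functions_smooth)

lemma test_functions_bounded:
  assumes "\<phi> \<in> test_functions \<Omega>"
  obtains C where "0 < C" "\<And>x. \<bar>\<phi> x\<bar> \<le> C"
proof -
  from assms obtain K where K: "compact K" "\<And>x. x \<notin> K \<Longrightarrow> \<phi> x = 0"
    by (auto simp: test_functions_iff)
  have "compact (\<phi> ` K)"
    by (intro compact_continuous_image K smooth_continuous_on test_functions_smooth[OF assms])
  then obtain C where C: "C > 0" "\<And>y. y \<in> \<phi> ` K \<Longrightarrow> norm y \<le> C"
    using compact_imp_bounded bounded_pos by metis
  have "\<bar>\<phi> x\<bar> \<le> C" for x using C K(2)[of x] by (cases "x \<in> K") auto
  then show ?thesis using that C by blast
qed

lemma test_functions_support:
  assumes "\<phi> \<in> test_functions \<Omega>"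
  obtains R where "0 < R" "\<And>x. R < norm x \<Longrightarrow> \<phi> x = 0"
proof -
  from assms obtain K where K: "compact K" "\<And>x. x \<notin> K \<Longrightarrow> \<phi> x = 0"
    by (auto simp: test_functions_iff)
  from K(1) obtain R where "R > 0" "\<And>x. x \<in> K \<Longrightarrow> norm x \<le> R"
    using compact_imp_bounded bounded_pos by metis
  then show ?thesis using that K(2) by (meson not_less)
qed

lemma test_functions_integrable:
  assumes "\<phi> \<in> test_functions \<Omega>"
  shows "integrable lborel \<phi>"
proof -
  obtain C where C: "0 < C" "\<And>x. \<bar>\<phi> x\<bar> \<le> C" by (rule test_functions_bounded[OF assms]) blast
  obtain R where R: "0 < R" "\<And>x. R < norm x \<Longrightarrow> \<phi> x = 0" by (rule test_functions_support[OF assms]) blast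
  show ?thesis
  proof (rule Bochner_Integration.integrable_bound)
    show "integrable lborel (\<lambda>x. C * indicator (cball 0 R) x)"
      by (intro integrable_mult_right integrable_real_indicator) (auto intro!: emeasure_bounded_finite[unfolded infinity_ennreal_def])
    show "AE x in lborel. norm (\<phi> x) \<le> norm (C * indicator (cball 0 R) x)"
      using C R by (auto simp: indicator_def not_le[symmetric])
  qed (use test_functions_borel[OF assms] in simp)
qed


section \<open>Integration by parts for test functions\<close>

lemma smooth_directional_derivative:
  assumes "smooth f"
  shows "((\<lambda>s. f (x + s *\<^sub>R b)) has_real_derivative partial_deriv b f (x + s *\<^sub>R b)) (at s)"
proof -
  have "((\<lambda>s. x + s *\<^sub>R b) has_derivative (\<lambda>h. h *\<^sub>R b)) (at s)"
    by (auto intro!: derivative_eq_intros)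
  from has_derivative_compose[OF this smooth_has_derivative[OF assms]]
  have "((\<lambda>s. f (x + s *\<^sub>R b)) has_derivative
      (\<lambda>h. frechet_derivative f (at (x + s *\<^sub>R b)) (h *\<^sub>R b))) (at s)" .
  moreover have "frechet_derivative f (at y) (h *\<^sub>R b) = partial_deriv b f y * h" for y h
    using linear_cmul[OF bounded_linear.linear[OF has_derivative_bounded_linear[OF
          smooth_has_derivative[OF assms, of y]]]]
    by (simp add: partial_deriv_def)
  ultimately show ?thesis by (simp add: has_field_derivative_def)
qed

text \<open>Translation invariance makes the integral of every difference quotient vanish. The
  quotients converge to the derivative, dominated through the mean value theorem.\<close>

lemma integral_partial_deriv_eq_0:
  fixes \<phi> :: "'a::euclidean_space \<Rightarrow> real"
  assumes \<phi>: "\<phi> \<in> test_functions \<Omega>" and b: "b \<in> Basis"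
  shows "(\<integral>x. partial_deriv b \<phi> x \<partial>lborel) = 0"
proof -
  define q where "q n x = (\<phi> (x + (1 / real (Suc n)) *\<^sub>R b) - \<phi> x) / (1 / real (Suc n))" for n x
  have D: "partial_deriv b \<phi> \<in> test_functions \<Omega>"
    using \<phi> b by (rule test_functions_partial_deriv)
  obtain C where C: "0 < C" "\<And>x. \<bar>partial_deriv b \<phi> x\<bar> \<le> C" by (rule test_functions_bounded[OF D]) blast
  obtain R where R: "0 < R" "\<And>x. R < norm x \<Longrightarrow> \<phi> x = 0" by (rule test_functions_support[OF \<phi>]) blast
  have [measurable]: "\<phi> \<in> borel_measurable borel" "partial_deriv b \<phi> \<in> borel_measurable borel"
    using \<phi> D by (auto intro: test_functions_borel)
  note deriv = smooth_directional_derivative[OF test_functions_smooth[OF \<phi>], of _ b]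
  have shift: "integrable lborel (\<lambda>x. \<phi> (c + x))" "(\<integral>x. \<phi> (c + x) \<partial>lborel) = (\<integral>x. \<phi> x \<partial>lborel)" for c
  proof -
    have "integrable (distr lborel borel ((+) c)) \<phi>"
      unfolding lborel_distr_plus by (rule test_functions_integrable[OF \<phi>])
    then show "integrable lborel (\<lambda>x. \<phi> (c + x))" by (subst (asm) integrable_distr_eq) auto
    have "(\<integral>x. \<phi> x \<partial>lborel) = (\<integral>x. \<phi> x \<partial>(distr lborel borel ((+) c)))"
      unfolding lborel_distr_plus ..
    also have "\<dots> = (\<integral>x. \<phi> (c + x) \<partial>lborel)" by (subst integral_distr) auto
    finally show "(\<integral>x. \<phi> (c + x) \<partial>lborel) = (\<integral>x. \<phi> x \<partial>lborel)" by simp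
  qed
  have q0: "(\<integral>x. q n x \<partial>lborel) = 0" for n
    unfolding q_def
    using shift[of "(1 / real (Suc n)) *\<^sub>R b"] test_functions_integrable[OF \<phi>]
    by (simp add: add.commute[of _ "_ *\<^sub>R b"])
  \<comment> \<open>The shifts have length at most 1, so outside the ball of radius R + 1 both terms
    of the quotient vanish.\<close>
  have bound: "norm (q n x) \<le> C * indicator (cball 0 (R + 1)) x" for n x
  proof (cases "norm x \<le> R + 1")
    case True
    define h where "h = 1 / real (Suc n)"
    have h: "0 < h" by (simp add: h_def)
    obtain z where "\<phi> (x + h *\<^sub>R b) - \<phi> (x + 0 *\<^sub>R b) = (h - 0) * partial_deriv b \<phi> (x + z *\<^sub>R b)"
      using MVT2[OF h deriv] by blast
    then have "q n x = partial_deriv b \<phi> (x + z *\<^sub>R b)"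
      using h unfolding q_def h_def[symmetric] by simp
    then show ?thesis using C(2) True by (simp add: dist_norm)
  next
    case False
    have "norm x \<le> norm (x + (1 / real (Suc n)) *\<^sub>R b) + norm ((1 / real (Suc n)) *\<^sub>R b)"
      using norm_triangle_ineq4[of "x + (1 / real (Suc n)) *\<^sub>R b" "(1 / real (Suc n)) *\<^sub>R b"] by simp
    also have "norm ((1 / real (Suc n)) *\<^sub>R b) \<le> 1" using b by simp
    finally have "R < norm (x + (1 / real (Suc n)) *\<^sub>R b)" using False by simp
    then show ?thesis using R(2) False by (simp add: q_def)
  qed
  have "(\<lambda>n. \<integral>x. q n x \<partial>lborel) \<longlonglongrightarrow> (\<integral>x. partial_deriv b \<phi> x \<partial>lborel)"
  proof (rule integral_dominated_convergence)
    show "integrable lborel (\<lambda>x. C * indicator (cball 0 (R + 1)) x :: real)"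
      by (intro integrable_mult_right integrable_real_indicator) (auto intro!: emeasure_bounded_finite[unfolded infinity_ennreal_def])
    show "AE x in lborel. (\<lambda>n. q n x) \<longlonglongrightarrow> partial_deriv b \<phi> x"
    proof (rule AE_I2)
      fix x
      have "((\<lambda>h. (\<phi> (x + h *\<^sub>R b) - \<phi> x) / h) \<longlongrightarrow> partial_deriv b \<phi> x) (at 0)"
        using deriv[of x 0] by (simp add: DERIV_def)
      moreover have "filterlim (\<lambda>n. 1 / real (Suc n)) (at 0) sequentially"
        unfolding filterlim_at using LIMSEQ_Suc[OF lim_1_over_n] by auto
      ultimately show "(\<lambda>n. q n x) \<longlonglongrightarrow> partial_deriv b \<phi> x"
        unfolding q_def by (rule filterlim_compose)
    qed
    show "q n \<in> borel_measurable lborel" for n unfolding q_def by measurable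
  qed (use bound in auto)
  then show ?thesis by (simp add: q0 LIMSEQ_const_iff)
qed

lemma partial_deriv_mult:
  assumes "smooth f" "smooth g"
  shows "partial_deriv b (\<lambda>x. f x * g x) x = f x * partial_deriv b g x + partial_deriv b f x * g x"
  using partial_deriv_eq[OF has_derivative_mult[OF smooth_has_derivative smooth_has_derivative, OF assms]]
  by (simp add: partial_deriv_def)

lemma partial_deriv_inner: "partial_deriv b (\<lambda>x. x \<bullet> v) x = b \<bullet> v"
  by (rule partial_deriv_eq) (auto intro!: derivative_eq_intros)

text \<open>The product f \<phi> is itself a test function, so its partial derivative has integral
  0; the product rule splits that integral.\<close>

lemma integration_by_parts:
  assumes "open \<Omega>" and \<phi>: "\<phi> \<in> test_functions \<Omega>" and f: "smooth f" and b: "b \<in> Basis"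
  shows "(\<integral>x. f x * partial_deriv b \<phi> x \<partial>(lebesgue_on \<Omega>)) =
      - (\<integral>x. partial_deriv b f x * \<phi> x \<partial>(lebesgue_on \<Omega>))"
proof -
  have mem: "(\<lambda>x. f x * partial_deriv b \<phi> x) \<in> test_functions \<Omega>"
    "(\<lambda>x. partial_deriv b f x * \<phi> x) \<in> test_functions \<Omega>"
    using \<phi> f b by (auto intro: test_functions_mult test_functions_partial_deriv smooth_partial_deriv)
  have "0 = (\<integral>x. partial_deriv b (\<lambda>x. f x * \<phi> x) x \<partial>lborel)"
    using integral_partial_deriv_eq_0[OF test_functions_mult[OF \<phi> f] b] by simp
  also have "\<dots> = (\<integral>x. f x * partial_deriv b \<phi> x + partial_deriv b f x * \<phi> x \<partial>lborel)"
    using partial_deriv_mult[OF f test_functions_smooth[OF \<phi>]] by simp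
  also have "\<dots> = (\<integral>x. f x * partial_deriv b \<phi> x \<partial>lborel) + (\<integral>x. partial_deriv b f x * \<phi> x \<partial>lborel)"
    by (intro Bochner_Integration.integral_add test_functions_integrable[OF mem(1)]
        test_functions_integrable[OF mem(2)])
  also have "\<dots> = (\<integral>x. f x * partial_deriv b \<phi> x \<partial>(lebesgue_on \<Omega>))
      + (\<integral>x. partial_deriv b f x * \<phi> x \<partial>(lebesgue_on \<Omega>))"
    by (intro arg_cong2[where f="(+)"] integral_lebesgue_on_eq_lborel[symmetric]
        assms(1) test_functions_borel[OF mem(1)] test_functions_borel[OF mem(2)]
        test_functions_vanish[OF mem(1)] test_functions_vanish[OF mem(2)])
  finally show ?thesis by simp
qed


section \<open>The fundamental lemma of the calculus of variations\<close>

text \<open>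
  If \<open>\<phi>\<^sub>0, \<phi>\<^sub>1, \<dots> \<ge> 0\<close> are test functions with open sets of positivity covering \<open>S\<close>, the test
  functions \<open>1 - exp (- n (\<phi>\<^sub>0 + \<dots> + \<phi>\<^sub>n))\<close> tend boundedly to the indicator function of \<open>S\<close>.
\<close>

lemma integral_open_eq_0:
  fixes h :: "'a::euclidean_space \<Rightarrow> real"
  assumes h: "integrable lborel h"
    and orth: "\<And>\<phi>. \<phi> \<in> test_functions \<Omega> \<Longrightarrow> (\<integral>x. h x * \<phi> x \<partial>lborel) = 0"
    and S: "open S" "S \<subseteq> \<Omega>"
  shows "(\<integral>x. h x * indicator S x \<partial>lborel) = 0"
proof (cases "S = {}")
  case False
  \<comment> \<open>Boxes with closure in S carry bump functions that are test functions on
    \<Omega>; Lindelof reduces the cover to countably many of them.\<close>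
  define \<C> where "\<C> = {box a b |a b. cbox a b \<subseteq> S}"
  have "\<Union>\<C> = S"
  proof
    show "\<Union>\<C> \<subseteq> S" using box_subset_cbox unfolding \<C>_def by blast
    show "S \<subseteq> \<Union>\<C>"
    proof
      fix x assume "x \<in> S"
      with S(1) obtain a b where "cbox a b \<subseteq> S" "x \<in> box a b" by (rule open_contains_cbox)
      then show "x \<in> \<Union>\<C>" unfolding \<C>_def by blast
    qed
  qed
  moreover have "open X" if "X \<in> \<C>" for X using that by (auto simp: \<C>_def open_box)
  ultimately obtain \<D> where \<D>: "\<D> \<subseteq> \<C>" "countable \<D>" "\<Union>\<D> = S"
    using Lindelof by metis
  have "\<D> \<noteq> {}" using \<D>(3) False by auto
  define X where "X = from_nat_into \<D>"
  have X: "X n \<in> \<C>" for n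
    using from_nat_into[OF \<open>\<D> \<noteq> {}\<close>] \<D>(1) unfolding X_def by blast
  have "range X = \<D>" unfolding X_def using \<open>\<D> \<noteq> {}\<close> \<D>(2) by (rule range_from_nat_into)
  then have UX: "(\<Union>n. X n) = S" using \<D>(3) by simp
  have "\<exists>\<phi>. \<phi> \<in> test_functions \<Omega> \<and> (\<forall>x. 0 \<le> \<phi> x) \<and> (\<forall>x. 0 < \<phi> x \<longleftrightarrow> x \<in> X n)" for n
  proof -
    from X[of n] obtain a b where ab: "X n = box a b" "cbox a b \<subseteq> \<Omega>"
      using S(2) unfolding \<C>_def by blast
    from ab(2) obtain \<phi> where "\<phi> \<in> test_functions \<Omega>" "\<And>x. 0 \<le> \<phi> x" "\<And>x. 0 < \<phi> x \<longleftrightarrow> x \<in> box a b"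
      by (rule obtain_box_bump) blast
    then show ?thesis using ab(1) by blast
  qed
  then obtain \<phi> where \<phi>: "\<And>n. \<phi> n \<in> test_functions \<Omega>" "\<And>n x. 0 \<le> \<phi> n x" "\<And>n x. 0 < \<phi> n x \<longleftrightarrow> x \<in> X n"
    by metis
  define \<psi> where "\<psi> n x = 1 - exp (- real n * (\<Sum>i\<le>n. \<phi> i x))" for n x
  have \<psi>_test: "\<psi> n \<in> test_functions \<Omega>" for n
    unfolding \<psi>_def by (intro test_functions_one_minus_exp test_functions_sum \<phi>(1))
  have \<psi>_bound: "\<bar>\<psi> n x\<bar> \<le> 1" for n x
    unfolding \<psi>_def using sum_nonneg[of "{..n}" "\<lambda>i. \<phi> i x"] \<phi>(2) by (simp add: abs_le_iff)
  have \<psi>_lim: "(\<lambda>n. \<psi> n x) \<longlonglongrightarrow> indicator S x" for x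
  proof (cases "x \<in> S")
    case True
    then obtain i where "x \<in> X i" using UX by blast
    then have pos: "0 < \<phi> i x" using \<phi>(3) by blast
    have "(\<lambda>n. exp (- (real n * \<phi> i x))) \<longlonglongrightarrow> 0"
      using pos by real_asymp
    \<comment> \<open>From n = i on, the sum contains the term \<phi> i x, which is positive for a
      box containing x.\<close>
    moreover have "\<forall>\<^sub>F n in sequentially. norm (exp (- real n * (\<Sum>i\<le>n. \<phi> i x))) \<le> exp (- (real n * \<phi> i x))"
      using eventually_ge_at_top[of i]
    proof eventually_elim
      case (elim n)
      have "\<phi> i x \<le> (\<Sum>i\<le>n. \<phi> i x)" using elim \<phi>(2) by (intro member_le_sum) auto
      then show ?case by (simp add: mult_left_mono)
    qed
    ultimately have "(\<lambda>n. exp (- real n * (\<Sum>i\<le>n. \<phi> i x))) \<longlonglongrightarrow> 0"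
      by (rule Lim_null_comparison[rotated])
    then have "(\<lambda>n. \<psi> n x) \<longlonglongrightarrow> 1 - 0" unfolding \<psi>_def by (intro tendsto_diff tendsto_const)
    then show ?thesis using True by simp
  next
    case False
    then have "\<phi> i x = 0" for i using UX \<phi>(2)[of i x] \<phi>(3)[of i x] by force
    then show ?thesis using False by (simp add: \<psi>_def)
  qed
  have [measurable]: "h \<in> borel_measurable borel" using borel_measurable_integrable[OF h] by simp
  have [measurable]: "\<psi> n \<in> borel_measurable borel" for n
    by (rule test_functions_borel[OF \<psi>_test])
  have "(\<lambda>n. \<integral>x. h x * \<psi> n x \<partial>lborel) \<longlonglongrightarrow> (\<integral>x. h x * indicator S x \<partial>lborel)"
  proof (rule integral_dominated_convergence)
    show "integrable lborel (\<lambda>x. \<bar>h x\<bar>)" using h by simp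
    show "AE x in lborel. (\<lambda>n. h x * \<psi> n x) \<longlonglongrightarrow> h x * indicator S x"
      by (intro AE_I2 tendsto_mult tendsto_const \<psi>_lim)
    show "AE x in lborel. norm (h x * \<psi> n x) \<le> \<bar>h x\<bar>" for n
      using \<psi>_bound by (intro AE_I2) (simp add: abs_mult mult_left_le)
  qed (use S(1) in auto)
  then show ?thesis by (simp add: orth[OF \<psi>_test] LIMSEQ_const_iff)
qed simp

text \<open>Open sets are stable under intersection and generate the Borel sets, so induction on
  Dynkin systems applies: complements use that \<open>UNIV\<close> is open, disjoint unions use
  countable additivity of the integral.\<close>

lemma integral_borel_eq_0:
  fixes h :: "'a::euclidean_space \<Rightarrow> real"
  assumes h: "integrable lborel h"
    and orth: "\<And>S. open S \<Longrightarrow> (\<integral>x. h x * indicator S x \<partial>lborel) = 0"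
    and A: "A \<in> sets borel"
  shows "(\<integral>x. h x * indicator A x \<partial>lborel) = 0"
proof -
  have int: "integrable lborel (\<lambda>x. h x * indicator A x)" if "A \<in> sets borel" for A
    using integrable_real_mult_indicator[of A lborel h] that h by (simp add: mult.commute)
  have "Int_stable {S :: 'a set. open S}" "{S :: 'a set. open S} \<subseteq> Pow UNIV"
    "A \<in> sigma_sets UNIV {S. open S}"
    using A by (auto simp: Int_stable_def borel_def)
  then show ?thesis
  proof (induction A rule: sigma_sets_induct_disjoint)
    case (compl A)
    then have A: "A \<in> sets borel" by (simp add: borel_def)
    have "(\<integral>x. h x * indicator (UNIV - A) x \<partial>lborel)
        = (\<integral>x. h x * indicator UNIV x - h x * indicator A x \<partial>lborel)"
      by (intro Bochner_Integration.integral_cong refl) (auto simp: indicator_def)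
    also have "\<dots> = 0"
      using orth[of UNIV] compl.IH int[OF A] int[of UNIV]
      by (subst Bochner_Integration.integral_diff) auto
    finally show ?case .
  next
    case (union A)
    then have A: "A i \<in> sets lborel" for i by (auto simp: borel_def)
    have "set_integrable lborel (\<Union>i. A i) h"
      using int[of "\<Union>i. A i"] A by (auto simp: set_integrable_def mult.commute)
    from lebesgue_integral_countable_add[OF A _ this] union
    have "(LINT x:(\<Union>i. A i)|lborel. h x) = 0"
      by (auto simp: disjoint_family_on_def set_lebesgue_integral_def mult.commute)
    then show ?case by (simp add: set_lebesgue_integral_def mult.commute)
  qed (auto simp: orth)
qed

text \<open>The Borel sets where h is positive and where h is negative together give that |h| has
  integral 0.\<close>

lemma AE_eq_0_if_integral_open_eq_0:
  fixes h :: "'a::euclidean_space \<Rightarrow> real"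
  assumes h: "integrable lborel h"
    and orth: "\<And>S. open S \<Longrightarrow> (\<integral>x. h x * indicator S x \<partial>lborel) = 0"
  shows "AE x in lborel. h x = 0"
proof -
  have [measurable]: "h \<in> borel_measurable borel" using borel_measurable_integrable[OF h] by simp
  have "(\<integral>x. \<bar>h x\<bar> \<partial>lborel) = (\<integral>x. h x * indicator {x. 0 < h x} x - h x * indicator {x. h x < 0} x \<partial>lborel)"
    by (intro Bochner_Integration.integral_cong refl) (auto simp: indicator_def)
  also have "\<dots> = (\<integral>x. h x * indicator {x. 0 < h x} x \<partial>lborel) - (\<integral>x. h x * indicator {x. h x < 0} x \<partial>lborel)"
    using integrable_real_mult_indicator[OF _ h, of "{x. 0 < h x}"]
      integrable_real_mult_indicator[OF _ h, of "{x. h x < 0}"]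
    by (intro Bochner_Integration.integral_diff) (simp_all add: mult.commute)
  also have "\<dots> = 0"
    using integral_borel_eq_0[OF h orth, of "{x. 0 < h x}"]
      integral_borel_eq_0[OF h orth, of "{x. h x < 0}"] by simp
  finally have "(\<integral>x. \<bar>h x\<bar> \<partial>lborel) = 0" .
  then show ?thesis
    using integral_nonneg_eq_0_iff_AE[of lborel "\<lambda>x. \<bar>h x\<bar>"] h by simp
qed

text \<open>h is only Lebesgue measurable and lives on \<Omega>, whereas the preceding lemmas
  concern \<open>lborel\<close>. It is extended by 0 and replaced by a Borel function k equal to it
  almost everywhere.\<close>

lemma fundamental_lemma_calculus_of_variations:
  fixes h :: "'a::euclidean_space \<Rightarrow> real"
  assumes \<Omega>: "open \<Omega>" and h: "integrable (lebesgue_on \<Omega>) h"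
    and orth: "\<And>\<phi>. \<phi> \<in> test_functions \<Omega> \<Longrightarrow> (\<integral>x. h x * \<phi> x \<partial>(lebesgue_on \<Omega>)) = 0"
  shows "AE x in lebesgue_on \<Omega>. h x = 0"
proof -
  have \<Omega>': "\<Omega> \<in> sets lebesgue" using \<Omega> by simp
  define h0 where "h0 x = (if x \<in> \<Omega> then h x else 0)" for x
  have h0: "integrable lebesgue h0"
    unfolding h0_def using h \<Omega>' by (simp add: Lebesgue_Measure.integrable_restrict_UNIV)
  then obtain k where k [measurable]: "k \<in> borel_measurable borel" and hk: "AE x in lborel. h0 x = k x"
    using completion_ex_borel_measurable_real[of h0 lborel] borel_measurable_integrable[OF h0] by auto
  have hk': "AE x in lebesgue. h0 x = k x" using hk by (rule AE_completion)
  have "integrable lebesgue k"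
    using h0 hk' by (subst integrable_cong_AE[of _ _ h0]) (auto intro: borel_measurable_integrable measurable_completion)
  then have k_int: "integrable lborel k" by (simp add: integrable_completion)
  have "(\<integral>x. k x * indicator S x \<partial>lborel) = 0" if S: "open S" for S
  proof -
    have "(\<integral>x. k x * \<phi> x \<partial>lborel) = 0" if \<phi>: "\<phi> \<in> test_functions \<Omega>" for \<phi>
    proof -
      have [measurable]: "\<phi> \<in> borel_measurable borel" by (rule test_functions_borel[OF \<phi>])
      have m: "\<phi> \<in> borel_measurable lebesgue" "k \<in> borel_measurable lebesgue"
        by (intro measurable_completion; simp)+
      have "(\<integral>x. k x * \<phi> x \<partial>lborel) = (\<integral>x. k x * \<phi> x \<partial>lebesgue)"
        by (intro integral_completion[symmetric]) simp
      also have "\<dots> = (\<integral>x. h0 x * \<phi> x \<partial>lebesgue)"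
      proof (rule integral_cong_AE)
        show "AE x in lebesgue. k x * \<phi> x = h0 x * \<phi> x" using hk' by eventually_elim simp
      qed (intro borel_measurable_times m borel_measurable_integrable[OF h0])+
      also have "(\<lambda>x. h0 x * \<phi> x) = (\<lambda>x. if x \<in> \<Omega> then h x * \<phi> x else 0)" by (auto simp: h0_def)
      also have "(\<integral>x. (if x \<in> \<Omega> then h x * \<phi> x else 0) \<partial>lebesgue) = 0"
        using orth[OF \<phi>] \<Omega>' by (simp add: Lebesgue_Measure.integral_restrict_UNIV)
      finally show ?thesis .
    qed
    from integral_open_eq_0[OF k_int this, where S = "S \<inter> \<Omega>"]
    have "(\<integral>x. k x * indicator (S \<inter> \<Omega>) x \<partial>lborel) = 0" using S \<Omega> by auto
    \<comment> \<open>k vanishes almost everywhere off \<Omega>; in this way all open S are reached,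
      as the Borel induction demands.\<close>
    also have "(\<integral>x. k x * indicator (S \<inter> \<Omega>) x \<partial>lborel) = (\<integral>x. k x * indicator S x \<partial>lborel)"
    proof (rule integral_cong_AE)
      show "AE x in lborel. k x * indicator (S \<inter> \<Omega>) x = k x * indicator S x"
        using hk by eventually_elim (auto simp: h0_def indicator_def split: if_splits)
    qed (use S \<Omega> in \<open>auto intro!: borel_measurable_times borel_measurable_indicator\<close>)
    finally show ?thesis .
  qed
  then have "AE x in lborel. k x = 0" by (rule AE_eq_0_if_integral_open_eq_0[OF k_int])
  then have "AE x in lebesgue. k x = 0" by (rule AE_completion)
  with hk' have "AE x in lebesgue. h0 x = 0" by eventually_elim simp
  then show ?thesis
    using \<Omega>' by (simp add: AE_restrict_space_iff h0_def) (auto elim: eventually_mono)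
qed


section \<open>Weak gradients\<close>

locale bounded_open =
  fixes \<Omega> :: "'a::euclidean_space set"
  assumes open_\<Omega>: "open \<Omega>" and bounded_\<Omega>: "bounded \<Omega>"
begin

lemma lmeasurable_\<Omega>: "\<Omega> \<in> lmeasurable"
  using bounded_\<Omega> open_\<Omega> by (rule lmeasurable_open)

lemma test_functions_L2:
  assumes "\<phi> \<in> test_functions \<Omega>"
  shows "\<phi> \<in> L2 \<Omega>"
proof -
  obtain C where C: "0 < C" "\<And>x. \<bar>\<phi> x\<bar> \<le> C" by (rule test_functions_bounded[OF assms]) blast
  show ?thesis
    by (rule L2_mono[OF const_in_L2[OF lmeasurable_\<Omega>, of C]])
      (use C test_functions_borel[OF assms] borel_imp_lebesgue_on_measurable in auto)
qed

lemma has_weak_gradient_iff: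
  "has_weak_gradient \<Omega> u g \<longleftrightarrow>
    (\<forall>\<phi>\<in>test_functions \<Omega>. \<forall>b\<in>Basis.
      L2_dot \<Omega> u (partial_deriv b \<phi>) = - L2_dot \<Omega> (\<lambda>x. g x \<bullet> b) \<phi>)"
  by (simp add: has_weak_gradient_def L2_dot_def)

lemma L2_component:
  assumes "g \<in> L2 \<Omega>" "b \<in> Basis"
  shows "(\<lambda>x. g x \<bullet> b) \<in> L2 \<Omega>" "L2_norm \<Omega> (\<lambda>x. g x \<bullet> b) \<le> L2_norm \<Omega> g"
proof -
  have m: "(\<lambda>x. g x \<bullet> b) \<in> borel_measurable (lebesgue_on \<Omega>)"
    using L2_measurable[OF assms(1)] by (intro borel_measurable_inner borel_measurable_const)
  have le: "norm (g x \<bullet> b) \<le> norm (g x)" for x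
    using Basis_le_norm[OF assms(2)] by simp
  show "(\<lambda>x. g x \<bullet> b) \<in> L2 \<Omega>" by (rule L2_mono[OF assms(1) m le])
  show "L2_norm \<Omega> (\<lambda>x. g x \<bullet> b) \<le> L2_norm \<Omega> g" by (rule L2_norm_mono[OF assms(1) m le])
qed

text \<open>Every coordinate of g - g' is orthogonal to all test functions. This ties the choice
  made in \<open>weak_gradient\<close> to any explicitly known weak gradient.\<close>

lemma has_weak_gradient_unique:
  assumes "g \<in> L2 \<Omega>" "g' \<in> L2 \<Omega>" "has_weak_gradient \<Omega> u g" "has_weak_gradient \<Omega> u g'"
  shows "AE x in lebesgue_on \<Omega>. g x = g' x"
proof -
  have "AE x in lebesgue_on \<Omega>. \<forall>b\<in>Basis. g x \<bullet> b - g' x \<bullet> b = 0"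
  proof (rule AE_finite_allI)
    fix b :: 'a assume b: "b \<in> Basis"
    note mem = L2_component(1)[OF assms(1) b] L2_component(1)[OF assms(2) b]
    have "(\<integral>x. (g x \<bullet> b - g' x \<bullet> b) * \<phi> x \<partial>(lebesgue_on \<Omega>)) = 0" if \<phi>: "\<phi> \<in> test_functions \<Omega>" for \<phi>
    proof -
      have "L2_dot \<Omega> (\<lambda>x. g x \<bullet> b - g' x \<bullet> b) \<phi> = L2_dot \<Omega> (\<lambda>x. g x \<bullet> b) \<phi> - L2_dot \<Omega> (\<lambda>x. g' x \<bullet> b) \<phi>"
        by (rule L2.diff_left[OF mem test_functions_L2[OF \<phi>]])
      also have "\<dots> = 0" using assms(3,4) \<phi> b unfolding has_weak_gradient_iff by force
      finally show ?thesis by (simp add: L2_dot_def)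
    qed
    then show "AE x in lebesgue_on \<Omega>. g x \<bullet> b - g' x \<bullet> b = 0"
      by (intro fundamental_lemma_calculus_of_variations open_\<Omega> L2_imp_integrable[OF lmeasurable_\<Omega>]
          L2.diff_mem mem)
  qed simp
  then show ?thesis by eventually_elim (auto intro: euclidean_eqI)
qed

lemma H1_L2: "u \<in> H1 \<Omega> \<Longrightarrow> u \<in> L2 \<Omega>"
  by (simp add: H1_def)

lemma weak_gradient:
  assumes "u \<in> H1 \<Omega>"
  shows weak_gradient_L2: "weak_gradient \<Omega> u \<in> L2 \<Omega>"
    and has_weak_gradient: "has_weak_gradient \<Omega> u (weak_gradient \<Omega> u)"
proof -
  have "\<exists>g. g \<in> L2 \<Omega> \<and> has_weak_gradient \<Omega> u g" using assms by (auto simp: H1_def)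
  from someI_ex[OF this] show "weak_gradient \<Omega> u \<in> L2 \<Omega>" "has_weak_gradient \<Omega> u (weak_gradient \<Omega> u)"
    by (simp_all add: weak_gradient_def)
qed

lemma H1_I: "u \<in> L2 \<Omega> \<Longrightarrow> g \<in> L2 \<Omega> \<Longrightarrow> has_weak_gradient \<Omega> u g \<Longrightarrow> u \<in> H1 \<Omega>"
  by (auto simp: H1_def)

lemma weak_gradient_AE_eq:
  assumes "u \<in> L2 \<Omega>" "g \<in> L2 \<Omega>" "has_weak_gradient \<Omega> u g"
  shows "AE x in lebesgue_on \<Omega>. weak_gradient \<Omega> u x = g x"
  using has_weak_gradient_unique[OF weak_gradient_L2 _ has_weak_gradient] H1_I[OF assms] assms
  by blast

lemma has_weak_gradient_add:
  assumes "u \<in> L2 \<Omega>" "v \<in> L2 \<Omega>" "g \<in> L2 \<Omega>" "h \<in> L2 \<Omega>"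
    "has_weak_gradient \<Omega> u g" "has_weak_gradient \<Omega> v h"
  shows "has_weak_gradient \<Omega> (\<lambda>x. u x + v x) (\<lambda>x. g x + h x)"
  unfolding has_weak_gradient_iff
proof (intro ballI)
  fix \<phi> and b :: 'a assume \<phi>: "\<phi> \<in> test_functions \<Omega>" and b: "b \<in> Basis"
  have D: "partial_deriv b \<phi> \<in> L2 \<Omega>"
    by (intro test_functions_L2 test_functions_partial_deriv \<phi> b)
  show "L2_dot \<Omega> (\<lambda>x. u x + v x) (partial_deriv b \<phi>) = - L2_dot \<Omega> (\<lambda>x. (g x + h x) \<bullet> b) \<phi>"
    unfolding L2.add_left[OF assms(1,2) D] inner_add_left
      L2.add_left[OF L2_component(1)[OF assms(3) b] L2_component(1)[OF assms(4) b] test_functions_L2[OF \<phi>]]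
    using assms(5,6) \<phi> b by (simp add: has_weak_gradient_iff)
qed

lemma has_weak_gradient_scale:
  assumes "u \<in> L2 \<Omega>" "g \<in> L2 \<Omega>" "has_weak_gradient \<Omega> u g"
  shows "has_weak_gradient \<Omega> (\<lambda>x. c *\<^sub>R u x) (\<lambda>x. c *\<^sub>R g x)"
  unfolding has_weak_gradient_iff
proof (intro ballI)
  fix \<phi> and b :: 'a assume \<phi>: "\<phi> \<in> test_functions \<Omega>" and b: "b \<in> Basis"
  have D: "partial_deriv b \<phi> \<in> L2 \<Omega>"
    by (intro test_functions_L2 test_functions_partial_deriv \<phi> b)
  show "L2_dot \<Omega> (\<lambda>x. c *\<^sub>R u x) (partial_deriv b \<phi>) = - L2_dot \<Omega> (\<lambda>x. (c *\<^sub>R g x) \<bullet> b) \<phi>"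
    unfolding L2.scale_left[OF assms(1) D] inner_scaleR_left
    using L2.scale_left[OF L2_component(1)[OF assms(2) b] test_functions_L2[OF \<phi>], of c] assms(3) \<phi> b
    by (simp add: has_weak_gradient_iff)
qed

text \<open>Closedness of the gradient: both sides of the defining identity are L2 products with a
  fixed function and so pass to the limit.\<close>

lemma has_weak_gradient_tendsto:
  assumes "\<And>n. w n \<in> L2 \<Omega>" "\<And>n. g n \<in> L2 \<Omega>" "\<And>n. has_weak_gradient \<Omega> (w n) (g n)"
    and "l \<in> L2 \<Omega>" "h \<in> L2 \<Omega>"
    and "(\<lambda>n. L2_norm \<Omega> (\<lambda>x. w n x - l x)) \<longlonglongrightarrow> 0" "(\<lambda>n. L2_norm \<Omega> (\<lambda>x. g n x - h x)) \<longlonglongrightarrow> 0"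
  shows "has_weak_gradient \<Omega> l h"
  unfolding has_weak_gradient_iff
proof (intro ballI)
  fix \<phi> and b :: 'a assume \<phi>: "\<phi> \<in> test_functions \<Omega>" and b: "b \<in> Basis"
  have D: "partial_deriv b \<phi> \<in> L2 \<Omega>"
    by (intro test_functions_L2 test_functions_partial_deriv \<phi> b)
  have "(\<lambda>n. L2_norm \<Omega> (\<lambda>x. g n x \<bullet> b - h x \<bullet> b)) \<longlonglongrightarrow> 0"
  proof (rule Lim_null_comparison[OF _ assms(7)])
    show "\<forall>\<^sub>F n in sequentially. norm (L2_norm \<Omega> (\<lambda>x. g n x \<bullet> b - h x \<bullet> b)) \<le> L2_norm \<Omega> (\<lambda>x. g n x - h x)"
      using L2_component(2)[OF L2.diff_mem[OF assms(2,5)] b]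
      by (simp add: inner_diff_left abs_of_nonneg L2_norm_nonneg)
  qed
  then have "(\<lambda>n. - L2_dot \<Omega> (\<lambda>x. g n x \<bullet> b) \<phi>) \<longlonglongrightarrow> - L2_dot \<Omega> (\<lambda>x. h x \<bullet> b) \<phi>"
    using L2_component(1)[OF assms(2) b] L2_component(1)[OF assms(5) b] test_functions_L2[OF \<phi>]
    by (intro tendsto_minus L2.tendsto_left) auto
  moreover have "(\<lambda>n. L2_dot \<Omega> (w n) (partial_deriv b \<phi>)) \<longlonglongrightarrow> L2_dot \<Omega> l (partial_deriv b \<phi>)"
    using assms D by (intro L2.tendsto_left) auto
  moreover have "L2_dot \<Omega> (w n) (partial_deriv b \<phi>) = - L2_dot \<Omega> (\<lambda>x. g n x \<bullet> b) \<phi>" for n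
    using assms(3) \<phi> b by (simp add: has_weak_gradient_iff)
  ultimately show "L2_dot \<Omega> l (partial_deriv b \<phi>) = - L2_dot \<Omega> (\<lambda>x. h x \<bullet> b) \<phi>"
    using LIMSEQ_unique by fastforce
qed

lemma H1_zero: "(\<lambda>x. 0) \<in> H1 \<Omega>"
  by (rule H1_I[OF L2.zero_mem L2.zero_mem]) (simp add: has_weak_gradient_def)

lemma H1_add:
  assumes "u \<in> H1 \<Omega>" "v \<in> H1 \<Omega>"
  shows "(\<lambda>x. u x + v x) \<in> H1 \<Omega>"
    and weak_gradient_add: "AE x in lebesgue_on \<Omega>.
      weak_gradient \<Omega> (\<lambda>x. u x + v x) x = weak_gradient \<Omega> u x + weak_gradient \<Omega> v x"
proof -
  have *: "(\<lambda>x. u x + v x) \<in> L2 \<Omega>" "(\<lambda>x. weak_gradient \<Omega> u x + weak_gradient \<Omega> v x) \<in> L2 \<Omega>"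
    "has_weak_gradient \<Omega> (\<lambda>x. u x + v x) (\<lambda>x. weak_gradient \<Omega> u x + weak_gradient \<Omega> v x)"
    by (rule L2.add_mem has_weak_gradient_add; intro weak_gradient H1_L2 assms)+
  show "(\<lambda>x. u x + v x) \<in> H1 \<Omega>" by (rule H1_I[OF *])
  show "AE x in lebesgue_on \<Omega>.
      weak_gradient \<Omega> (\<lambda>x. u x + v x) x = weak_gradient \<Omega> u x + weak_gradient \<Omega> v x"
    by (rule weak_gradient_AE_eq[OF *])
qed

lemma H1_scale:
  assumes "u \<in> H1 \<Omega>"
  shows "(\<lambda>x. c *\<^sub>R u x) \<in> H1 \<Omega>"
    and weak_gradient_scale: "AE x in lebesgue_on \<Omega>.
      weak_gradient \<Omega> (\<lambda>x. c *\<^sub>R u x) x = c *\<^sub>R weak_gradient \<Omega> u x"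
proof -
  have *: "(\<lambda>x. c *\<^sub>R u x) \<in> L2 \<Omega>" "(\<lambda>x. c *\<^sub>R weak_gradient \<Omega> u x) \<in> L2 \<Omega>"
    "has_weak_gradient \<Omega> (\<lambda>x. c *\<^sub>R u x) (\<lambda>x. c *\<^sub>R weak_gradient \<Omega> u x)"
    by (rule L2.scale_mem has_weak_gradient_scale; intro weak_gradient H1_L2 assms)+
  show "(\<lambda>x. c *\<^sub>R u x) \<in> H1 \<Omega>" by (rule H1_I[OF *])
  show "AE x in lebesgue_on \<Omega>. weak_gradient \<Omega> (\<lambda>x. c *\<^sub>R u x) x = c *\<^sub>R weak_gradient \<Omega> u x"
    by (rule weak_gradient_AE_eq[OF *])
qed

section \<open>The inner product of \<open>H1\<close>\<close>

definition H1_dot :: "('a \<Rightarrow> real) \<Rightarrow> ('a \<Rightarrow> real) \<Rightarrow> real" where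
  "H1_dot u v = L2_dot \<Omega> u v + L2_dot \<Omega> (weak_gradient \<Omega> u) (weak_gradient \<Omega> v)"

sublocale H1: semi_inner "H1 \<Omega>" H1_dot
  rewrites nrm_H1_dot: "semi_inner.nrm H1_dot = H1_norm \<Omega>"
proof -
  show *: "semi_inner (H1 \<Omega>) H1_dot"
  proof
    fix u v w :: "'a \<Rightarrow> real" and c :: real
    show "(\<lambda>x. 0) \<in> H1 \<Omega>" by (rule H1_zero)
    show "(\<lambda>x. u x + v x) \<in> H1 \<Omega>" if "u \<in> H1 \<Omega>" "v \<in> H1 \<Omega>" using that by (rule H1_add)
    show "(\<lambda>x. c *\<^sub>R u x) \<in> H1 \<Omega>" if "u \<in> H1 \<Omega>" using that by (rule H1_scale)
    show "H1_dot u v = H1_dot v u" if "u \<in> H1 \<Omega>" "v \<in> H1 \<Omega>"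
      using that by (simp add: H1_dot_def L2.sym[of u] L2.sym[of "weak_gradient \<Omega> u"] H1_L2 weak_gradient_L2)
    show "0 \<le> H1_dot u u" if "u \<in> H1 \<Omega>"
      using that by (simp add: H1_dot_def L2.nonneg H1_L2 weak_gradient_L2)
    show "H1_dot (\<lambda>x. u x + v x) w = H1_dot u w + H1_dot v w"
      if u: "u \<in> H1 \<Omega>" and v: "v \<in> H1 \<Omega>" and w: "w \<in> H1 \<Omega>"
    proof -
      note g = weak_gradient_L2[OF u] weak_gradient_L2[OF v] weak_gradient_L2[OF w]
      \<comment> \<open>The chosen gradient of a sum is the sum of the chosen gradients only up to a
        null set, which the integral does not see.\<close>
      have "L2_dot \<Omega> (weak_gradient \<Omega> (\<lambda>x. u x + v x)) (weak_gradient \<Omega> w)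
          = L2_dot \<Omega> (\<lambda>x. weak_gradient \<Omega> u x + weak_gradient \<Omega> v x) (weak_gradient \<Omega> w)"
        by (rule L2_dot_AE_cong[OF weak_gradient_L2[OF H1_add(1)[OF u v]] L2.add_mem[OF g(1,2)] g(3) g(3)
            weak_gradient_add[OF u v]]) simp
      then show ?thesis
        unfolding H1_dot_def L2.add_left[OF H1_L2[OF u] H1_L2[OF v] H1_L2[OF w]]
        by (simp add: L2.add_left[OF g])
    qed
    show "H1_dot (\<lambda>x. c *\<^sub>R u x) v = c * H1_dot u v"
      if u: "u \<in> H1 \<Omega>" and v: "v \<in> H1 \<Omega>"
    proof -
      note g = weak_gradient_L2[OF u] weak_gradient_L2[OF v]
      have "L2_dot \<Omega> (weak_gradient \<Omega> (\<lambda>x. c *\<^sub>R u x)) (weak_gradient \<Omega> v)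
          = L2_dot \<Omega> (\<lambda>x. c *\<^sub>R weak_gradient \<Omega> u x) (weak_gradient \<Omega> v)"
        by (rule L2_dot_AE_cong[OF weak_gradient_L2[OF H1_scale(1)[OF u]] L2.scale_mem[OF g(1)] g(2) g(2)
            weak_gradient_scale[OF u]]) simp
      then show ?thesis
        unfolding H1_dot_def L2.scale_left[OF H1_L2[OF u] H1_L2[OF v]]
        by (simp only: L2.scale_left[OF g] distrib_left)
    qed
  qed
  show "semi_inner.nrm H1_dot = H1_norm \<Omega>"
    by (simp add: fun_eq_iff semi_inner.nrm_def[OF *] H1_norm_def H1_dot_def L2_norm_def L2_dot_def
        power2_norm_eq_inner, simp add: power2_eq_square)
qed

lemma L2_norm_le_H1_norm: "L2_norm \<Omega> u \<le> H1_norm \<Omega> u"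
  by (simp add: H1_norm_def)

lemma L2_norm_weak_gradient_le_H1_norm: "L2_norm \<Omega> (weak_gradient \<Omega> u) \<le> H1_norm \<Omega> u"
  by (simp add: H1_norm_def)

lemma L2_norm_weak_gradient_diff:
  assumes "u \<in> H1 \<Omega>" "v \<in> H1 \<Omega>"
  shows "L2_norm \<Omega> (weak_gradient \<Omega> (\<lambda>x. u x - v x))
    = L2_norm \<Omega> (\<lambda>x. weak_gradient \<Omega> u x - weak_gradient \<Omega> v x)"
proof (rule L2_norm_AE_cong)
  \<comment> \<open>As v + (u - v) = u, additivity alone yields the rule for differences.\<close>
  have "AE x in lebesgue_on \<Omega>. weak_gradient \<Omega> (\<lambda>x. v x + (u x - v x)) x
      = weak_gradient \<Omega> v x + weak_gradient \<Omega> (\<lambda>x. u x - v x) x"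
    by (intro weak_gradient_add H1.diff_mem assms)
  then show "AE x in lebesgue_on \<Omega>. weak_gradient \<Omega> (\<lambda>x. u x - v x) x
      = weak_gradient \<Omega> u x - weak_gradient \<Omega> v x"
    by eventually_elim simp
qed (use assms in \<open>auto intro!: L2_measurable weak_gradient_L2 H1.diff_mem L2.diff_mem\<close>)

text \<open>The defining identity involves u only under the integral, so 0 is a weak gradient of u;
  uniqueness does the rest.\<close>

lemma L2_norm_weak_gradient_AE_0:
  assumes "u \<in> H1 \<Omega>" "AE x in lebesgue_on \<Omega>. u x = 0"
  shows "L2_norm \<Omega> (weak_gradient \<Omega> u) = 0"
proof -
  have "has_weak_gradient \<Omega> u (\<lambda>x. 0)"
    unfolding has_weak_gradient_iff
  proof (intro ballI)
    fix \<phi> and b :: 'a assume \<phi>: "\<phi> \<in> test_functions \<Omega>" and b: "b \<in> Basis"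
    have D: "partial_deriv b \<phi> \<in> L2 \<Omega>"
      by (intro test_functions_L2 test_functions_partial_deriv \<phi> b)
    have "L2_dot \<Omega> u (partial_deriv b \<phi>) = L2_dot \<Omega> (\<lambda>x. 0) (partial_deriv b \<phi>)"
      by (rule L2_dot_AE_cong[OF H1_L2[OF assms(1)] L2.zero_mem D D assms(2)]) simp
    then show "L2_dot \<Omega> u (partial_deriv b \<phi>) = - L2_dot \<Omega> (\<lambda>x. 0 \<bullet> b) \<phi>"
      by (simp add: L2_dot_def)
  qed
  from weak_gradient_AE_eq[OF H1_L2[OF assms(1)] L2.zero_mem this] show ?thesis
    by (rule L2_norm_AE_0)
qed


section \<open>Functions vanishing on the boundary\<close>

lemma test_functions_has_weak_gradient:
  assumes \<phi>: "\<phi> \<in> test_functions \<Omega>"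
  defines "g \<equiv> (\<lambda>x. \<Sum>b\<in>Basis. partial_deriv b \<phi> x *\<^sub>R b)"
  shows "g \<in> L2 \<Omega>" "has_weak_gradient \<Omega> \<phi> g"
proof -
  have "(\<lambda>x. partial_deriv b \<phi> x *\<^sub>R b) \<in> L2 \<Omega>" if b: "b \<in> Basis" for b
  proof (rule L2_mono)
    show D: "partial_deriv b \<phi> \<in> L2 \<Omega>"
      by (intro test_functions_L2 test_functions_partial_deriv \<phi> b)
    show "(\<lambda>x. partial_deriv b \<phi> x *\<^sub>R b) \<in> borel_measurable (lebesgue_on \<Omega>)"
      by (intro borel_measurable_scaleR L2_measurable[OF D] borel_measurable_const)
    show "norm (partial_deriv b \<phi> x *\<^sub>R b) \<le> norm (partial_deriv b \<phi> x)" for x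
      using b by simp
  qed
  from L2.sum_mem[of Basis "\<lambda>b x. partial_deriv b \<phi> x *\<^sub>R b" \<Omega> "\<lambda>_. 1", OF this]
  show "g \<in> L2 \<Omega>" by (simp add: g_def)
  show "has_weak_gradient \<Omega> \<phi> g"
    unfolding has_weak_gradient_def g_def
    using integration_by_parts[OF open_\<Omega> _ test_functions_smooth[OF \<phi>]] by simp
qed

lemma test_functions_H1: "\<phi> \<in> test_functions \<Omega> \<Longrightarrow> \<phi> \<in> H1 \<Omega>"
  using H1_I[OF test_functions_L2 test_functions_has_weak_gradient] .

text \<open>Integrating \<open>\<phi>\<^sup>2\<close> by parts against the linear function \<open>x \<mapsto> x \<bullet> b\<close>, which is bounded on \<open>\<Omega>\<close>.\<close>

lemma Poincare_test_functions:
  assumes \<phi>: "\<phi> \<in> test_functions \<Omega>" and R: "0 < R" "\<And>x. x \<in> \<Omega> \<Longrightarrow> norm x \<le> R"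
  shows "L2_norm \<Omega> \<phi> \<le> 2 * R * L2_norm \<Omega> (weak_gradient \<Omega> \<phi>)"
proof -
  obtain b :: 'a where b: "b \<in> Basis" using nonempty_Basis by blast
  \<comment> \<open>The linear weight has derivative 1 in direction b, so differentiating f produces
    \<phi> itself.\<close>
  define f where "f x = (x \<bullet> b) * \<phi> x" for x
  have f: "f \<in> test_functions \<Omega>"
    unfolding f_def by (intro test_functions_mult \<phi> smooth_inner)
  have D: "partial_deriv b \<phi> \<in> test_functions \<Omega>"
    by (intro test_functions_partial_deriv \<phi> b)
  note L2s = test_functions_L2[OF \<phi>] test_functions_L2[OF f] test_functions_L2[OF D]
  have Df: "partial_deriv b f x = (x \<bullet> b) * partial_deriv b \<phi> x + \<phi> x" for x
    unfolding f_def partial_deriv_mult[OF smooth_inner test_functions_smooth[OF \<phi>]]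
    using b by (simp add: partial_deriv_inner)
  have "L2_dot \<Omega> f (partial_deriv b \<phi>) = - (\<integral>x. partial_deriv b f x * \<phi> x \<partial>(lebesgue_on \<Omega>))"
    using integration_by_parts[OF open_\<Omega> \<phi> test_functions_smooth[OF f] b] by (simp add: L2_dot_def)
  also have "(\<lambda>x. partial_deriv b f x * \<phi> x) = (\<lambda>x. f x \<bullet> partial_deriv b \<phi> x + \<phi> x \<bullet> \<phi> x)"
    by (simp add: Df f_def fun_eq_iff algebra_simps)
  also have "(\<integral>x. f x \<bullet> partial_deriv b \<phi> x + \<phi> x \<bullet> \<phi> x \<partial>(lebesgue_on \<Omega>))
      = L2_dot \<Omega> f (partial_deriv b \<phi>) + L2_dot \<Omega> \<phi> \<phi>"
    unfolding L2_dot_def by (intro Bochner_Integration.integral_add L2_integrable_inner L2s)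
  \<comment> \<open>The product of f and the derivative of \<phi> occurs on both sides of the
    integration by parts, hence the factor 2.\<close>
  finally have "(L2_norm \<Omega> \<phi>)\<^sup>2 = - 2 * L2_dot \<Omega> f (partial_deriv b \<phi>)"
    using L2.nrm_power2[OF L2s(1)] by linarith
  also have "\<dots> \<le> 2 * (L2_norm \<Omega> f * L2_norm \<Omega> (partial_deriv b \<phi>))"
    using L2.Cauchy_Schwarz[OF L2s(2,3)] by linarith
  also have "\<dots> \<le> 2 * ((R * L2_norm \<Omega> \<phi>) * L2_norm \<Omega> (weak_gradient \<Omega> \<phi>))"
  proof (intro mult_left_mono mult_mono)
    have "norm (f x) \<le> norm (R *\<^sub>R \<phi> x)" for x
    proof (cases "x \<in> \<Omega>")
      case True
      then have "\<bar>x \<bullet> b\<bar> \<le> R" using Basis_le_norm[OF b, of x] R(2)[of x] by linarith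
      then show ?thesis using R(1) by (simp add: f_def abs_mult mult_right_mono)
    qed (simp add: f_def test_functions_vanish[OF \<phi>])
    then have "L2_norm \<Omega> f \<le> L2_norm \<Omega> (\<lambda>x. R *\<^sub>R \<phi> x)"
      by (intro L2_norm_mono L2.scale_mem L2s L2_measurable)
    then show "L2_norm \<Omega> f \<le> R * L2_norm \<Omega> \<phi>"
      using R(1) L2.nrm_scale[OF L2s(1), of R] by simp
    have "AE x in lebesgue_on \<Omega>. weak_gradient \<Omega> \<phi> x \<bullet> b = partial_deriv b \<phi> x"
      using weak_gradient_AE_eq[OF L2s(1) test_functions_has_weak_gradient[OF \<phi>]]
      by eventually_elim (use b in simp)
    then have "L2_norm \<Omega> (partial_deriv b \<phi>) = L2_norm \<Omega> (\<lambda>x. weak_gradient \<Omega> \<phi> x \<bullet> b)"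
      using L2_measurable[OF L2s(3)]
        L2_measurable[OF L2_component(1)[OF weak_gradient_L2[OF test_functions_H1[OF \<phi>]] b]]
      by (intro L2_norm_AE_cong) auto
    then show "L2_norm \<Omega> (partial_deriv b \<phi>) \<le> L2_norm \<Omega> (weak_gradient \<Omega> \<phi>)"
      using L2_component(2)[OF weak_gradient_L2[OF test_functions_H1[OF \<phi>]] b] by simp
  qed (use R in \<open>auto simp: L2_norm_nonneg\<close>)
  finally have "(L2_norm \<Omega> \<phi>)\<^sup>2 \<le> 2 * R * L2_norm \<Omega> (weak_gradient \<Omega> \<phi>) * L2_norm \<Omega> \<phi>"
    by (simp add: mult_ac)
  then show ?thesis
    by (rule power2_le_if_power2_le_mult[rotated 2]) (use R in \<open>auto simp: L2_norm_nonneg\<close>)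
qed

lemma H01_H1: "u \<in> H01 \<Omega> \<Longrightarrow> u \<in> H1 \<Omega>"
  by (simp add: H01_def)

lemma H01_L2: "u \<in> H01 \<Omega> \<Longrightarrow> u \<in> L2 \<Omega>"
  by (intro H1_L2 H01_H1)

text \<open>The constant 2 R for test functions does not depend on the function and survives
  approximation in the H1 norm.\<close>

lemma Poincare: "\<exists>K\<ge>0. \<forall>u\<in>H01 \<Omega>. L2_norm \<Omega> u \<le> K * L2_norm \<Omega> (weak_gradient \<Omega> u)"
proof -
  obtain R where R: "0 < R" "\<And>x. x \<in> \<Omega> \<Longrightarrow> norm x \<le> R"
    using bounded_\<Omega> bounded_pos by blast
  have "L2_norm \<Omega> u \<le> 2 * R * L2_norm \<Omega> (weak_gradient \<Omega> u)" if u: "u \<in> H01 \<Omega>" for u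
  proof -
    obtain \<phi> where \<phi>: "\<And>n. \<phi> n \<in> test_functions \<Omega>"
      and lim: "(\<lambda>n. H1_norm \<Omega> (\<lambda>x. \<phi> n x - u x)) \<longlonglongrightarrow> 0"
      using u unfolding H01_def by blast
    define G where "G v = L2_norm \<Omega> (weak_gradient \<Omega> v)" for v
    define \<delta> where "\<delta> n = H1_norm \<Omega> (\<lambda>x. \<phi> n x - u x)" for n
    note uH1 = H01_H1[OF u] and \<phi>H1 = test_functions_H1[OF \<phi>]
    \<comment> \<open>One \<delta> n for replacing u by \<phi> n, and 2 R \<delta> n for replacing
      its gradient.\<close>
    have "L2_norm \<Omega> u \<le> (1 + 2 * R) * \<delta> n + 2 * R * G u" for n
    proof -
      have "L2_norm \<Omega> u \<le> L2_norm \<Omega> (\<lambda>x. \<phi> n x - u x) + L2_norm \<Omega> (\<phi> n)"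
        using L2.nrm_le_diff[OF H1_L2[OF uH1] H1_L2[OF \<phi>H1]]
          L2.nrm_diff_commute[OF H1_L2[OF uH1] H1_L2[OF \<phi>H1]] by simp
      also have "\<dots> \<le> \<delta> n + 2 * R * G (\<phi> n)"
        unfolding \<delta>_def G_def
        by (intro add_mono L2_norm_le_H1_norm Poincare_test_functions[OF \<phi> R])
      also have "G (\<phi> n) \<le> L2_norm \<Omega> (\<lambda>x. weak_gradient \<Omega> (\<phi> n) x - weak_gradient \<Omega> u x) + G u"
        unfolding G_def
        by (rule L2.nrm_le_diff[OF weak_gradient_L2[OF \<phi>H1] weak_gradient_L2[OF uH1]])
      also have "\<dots> \<le> \<delta> n + G u"
        unfolding L2_norm_weak_gradient_diff[OF \<phi>H1 uH1, symmetric] \<delta>_def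
        using L2_norm_weak_gradient_le_H1_norm by simp
      finally show ?thesis using R(1) by (simp add: algebra_simps)
    qed
    moreover have "(\<lambda>n. (1 + 2 * R) * \<delta> n + 2 * R * G u) \<longlonglongrightarrow> (1 + 2 * R) * 0 + 2 * R * G u"
      using lim unfolding \<delta>_def by (intro tendsto_intros)
    ultimately have "L2_norm \<Omega> u \<le> (1 + 2 * R) * 0 + 2 * R * G u"
      by (intro LIMSEQ_le_const[of "\<lambda>n. (1 + 2 * R) * \<delta> n + 2 * R * G u"]) auto
    then show ?thesis by (simp add: G_def)
  qed
  then show ?thesis using R(1) by (intro exI[of _ "2 * R"]) auto
qed

text \<open>Diagonal choice: a test function within 1/(n+1) of w n. Besides completeness, this also
  yields the vector space structure of \<open>H01\<close>.\<close>

lemma H01_closed: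
  assumes "\<And>n. w n \<in> H01 \<Omega>" "l \<in> H1 \<Omega>" "(\<lambda>n. H1_norm \<Omega> (\<lambda>x. w n x - l x)) \<longlonglongrightarrow> 0"
  shows "l \<in> H01 \<Omega>"
proof -
  have "\<exists>\<phi>\<in>test_functions \<Omega>. H1_norm \<Omega> (\<lambda>x. \<phi> x - w n x) < 1 / real (Suc n)" for n
  proof -
    obtain \<phi> where "\<And>k. \<phi> k \<in> test_functions \<Omega>" "(\<lambda>k. H1_norm \<Omega> (\<lambda>x. \<phi> k x - w n x)) \<longlonglongrightarrow> 0"
      using assms(1)[of n] unfolding H01_def by blast
    moreover from this(2) have "\<forall>\<^sub>F k in sequentially. H1_norm \<Omega> (\<lambda>x. \<phi> k x - w n x) < 1 / real (Suc n)"
      by (rule order_tendstoD) simp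
    ultimately show ?thesis by (auto simp: eventually_sequentially)
  qed
  then obtain \<phi> where \<phi>: "\<And>n. \<phi> n \<in> test_functions \<Omega>"
    "\<And>n. H1_norm \<Omega> (\<lambda>x. \<phi> n x - w n x) < 1 / real (Suc n)" by metis
  have "(\<lambda>n. H1_norm \<Omega> (\<lambda>x. \<phi> n x - l x)) \<longlonglongrightarrow> 0"
  proof (rule Lim_null_comparison)
    have "(\<lambda>n. 1 / real (Suc n) + H1_norm \<Omega> (\<lambda>x. w n x - l x)) \<longlonglongrightarrow> 0 + 0"
      by (intro tendsto_add LIMSEQ_Suc[OF lim_1_over_n] assms(3))
    then show "(\<lambda>n. 1 / real (Suc n) + H1_norm \<Omega> (\<lambda>x. w n x - l x)) \<longlonglongrightarrow> 0" by simp
    have "norm (H1_norm \<Omega> (\<lambda>x. \<phi> n x - l x)) \<le> 1 / real (Suc n) + H1_norm \<Omega> (\<lambda>x. w n x - l x)" for n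
      using H1.nrm_triangle_diff[OF test_functions_H1[OF \<phi>(1)] H01_H1[OF assms(1)] assms(2), of n n]
        \<phi>(2)[of n] H1.nrm_nonneg[OF H1.diff_mem[OF test_functions_H1[OF \<phi>(1)] assms(2)], of n]
      unfolding real_norm_def by linarith
    then show "\<forall>\<^sub>F n in sequentially. norm (H1_norm \<Omega> (\<lambda>x. \<phi> n x - l x))
        \<le> 1 / real (Suc n) + H1_norm \<Omega> (\<lambda>x. w n x - l x)" by simp
  qed
  then show ?thesis using assms(2) \<phi>(1) unfolding H01_def by blast
qed

lemma test_functions_H01: "\<phi> \<in> test_functions \<Omega> \<Longrightarrow> \<phi> \<in> H01 \<Omega>"
  using test_functions_H1 H1.zero_left[OF H1.zero_mem]
  by (auto simp: H01_def H1.nrm_def intro!: exI[of _ "\<lambda>_. \<phi>"])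

lemma H01_zero: "(\<lambda>x. 0) \<in> H01 \<Omega>"
  by (intro test_functions_H01 test_functions_zero)

lemma H01_scale:
  assumes u: "u \<in> H01 \<Omega>"
  shows "(\<lambda>x. c *\<^sub>R u x) \<in> H01 \<Omega>"
proof -
  obtain \<phi> where \<phi>: "\<And>n. \<phi> n \<in> test_functions \<Omega>"
    and lim: "(\<lambda>n. H1_norm \<Omega> (\<lambda>x. \<phi> n x - u x)) \<longlonglongrightarrow> 0"
    using u unfolding H01_def by blast
  have "H1_norm \<Omega> (\<lambda>x. c *\<^sub>R \<phi> n x - c *\<^sub>R u x) = \<bar>c\<bar> * H1_norm \<Omega> (\<lambda>x. \<phi> n x - u x)" for n
    using H1.nrm_scale[OF H1.diff_mem[OF test_functions_H1[OF \<phi>] H01_H1[OF u]], of c]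
    by (simp add: right_diff_distrib)
  then have lim': "(\<lambda>n. H1_norm \<Omega> (\<lambda>x. c *\<^sub>R \<phi> n x - c *\<^sub>R u x)) \<longlonglongrightarrow> 0"
    using tendsto_mult_left[OF lim, of "\<bar>c\<bar>"] by simp
  have "(\<lambda>x. c *\<^sub>R \<phi> n x) \<in> H01 \<Omega>" for n
    using test_functions_H01[OF test_functions_mult[OF \<phi> smooth_const]] by simp
  then show ?thesis by (rule H01_closed[OF _ H1_scale(1)[OF H01_H1[OF u]] lim'])
qed

lemma H01_add:
  assumes u: "u \<in> H01 \<Omega>" and v: "v \<in> H01 \<Omega>"
  shows "(\<lambda>x. u x + v x) \<in> H01 \<Omega>"
proof -
  obtain \<phi> where \<phi>: "\<And>n. \<phi> n \<in> test_functions \<Omega>"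
    and lim: "(\<lambda>n. H1_norm \<Omega> (\<lambda>x. \<phi> n x - u x)) \<longlonglongrightarrow> 0"
    using u unfolding H01_def by blast
  obtain \<psi> where \<psi>: "\<And>n. \<psi> n \<in> test_functions \<Omega>"
    and lim': "(\<lambda>n. H1_norm \<Omega> (\<lambda>x. \<psi> n x - v x)) \<longlonglongrightarrow> 0"
    using v unfolding H01_def by blast
  have "H1_norm \<Omega> (\<lambda>x. (\<phi> n x + \<psi> n x) - (u x + v x))
      \<le> H1_norm \<Omega> (\<lambda>x. \<phi> n x - u x) + H1_norm \<Omega> (\<lambda>x. \<psi> n x - v x)" for n
    using H1.nrm_triangle[OF H1.diff_mem[OF test_functions_H1[OF \<phi>] H01_H1[OF u]]
        H1.diff_mem[OF test_functions_H1[OF \<psi>] H01_H1[OF v]], of n n]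
    by (simp add: algebra_simps)
  then have "(\<lambda>n. H1_norm \<Omega> (\<lambda>x. (\<phi> n x + \<psi> n x) - (u x + v x))) \<longlonglongrightarrow> 0"
    using H1.nrm_nonneg[OF H1.diff_mem[OF test_functions_H1[OF test_functions_add[OF \<phi> \<psi>]]
          H1_add(1)[OF H01_H1[OF u] H01_H1[OF v]]]]
    by (intro Lim_null_comparison[OF _ tendsto_add_zero[OF lim lim']]) simp
  then show ?thesis
    by (rule H01_closed[OF test_functions_H01[OF test_functions_add[OF \<phi> \<psi>]]
          H1_add(1)[OF H01_H1[OF u] H01_H1[OF v]]])
qed

end


section \<open>The solution operator\<close>

locale elliptic_form = bounded_open \<Omega> for \<Omega> :: "'a::euclidean_space set" +
  fixes \<V> :: "'a \<Rightarrow> real" and c1 c2 :: real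
  assumes inner_product: "inner_product_on_H01 \<Omega> (bilin \<Omega> \<V>)"
    and c1_pos: "0 < c1" and c2_pos: "0 < c2"
    and coercive: "u \<in> H01 \<Omega> \<Longrightarrow> c1 * (L2_norm \<Omega> (weak_gradient \<Omega> u))\<^sup>2 \<le> bilin \<Omega> \<V> u u"
    and bounded_form: "u \<in> H01 \<Omega> \<Longrightarrow> bilin \<Omega> \<V> u u \<le> c2 * (L2_norm \<Omega> (weak_gradient \<Omega> u))\<^sup>2"
begin

sublocale A: semi_inner "H01 \<Omega>" "bilin \<Omega> \<V>"
proof
  fix u v w :: "'a \<Rightarrow> real" and c :: real
  show "(\<lambda>x. 0) \<in> H01 \<Omega>" by (rule H01_zero)
  show "(\<lambda>x. u x + v x) \<in> H01 \<Omega>" if "u \<in> H01 \<Omega>" "v \<in> H01 \<Omega>" using that by (rule H01_add)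
  show "(\<lambda>x. c *\<^sub>R u x) \<in> H01 \<Omega>" if "u \<in> H01 \<Omega>" using that by (rule H01_scale)
qed (use inner_product in \<open>simp_all only: inner_product_on_H01_def real_scaleR_def\<close>)

section \<open>Comparison of the energy norm with the Sobolev norm, and completeness\<close>

lemma L2_norm_weak_gradient_le_nrm:
  assumes "u \<in> H01 \<Omega>"
  shows "L2_norm \<Omega> (weak_gradient \<Omega> u) \<le> A.nrm u / sqrt c1"
proof -
  have "sqrt (c1 * (L2_norm \<Omega> (weak_gradient \<Omega> u))\<^sup>2) \<le> A.nrm u"
    unfolding A.nrm_def by (intro real_sqrt_le_mono coercive assms)
  then show ?thesis using c1_pos by (simp add: real_sqrt_mult L2_norm_nonneg field_simps)
qed

lemma nrm_le_L2_norm_weak_gradient: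
  assumes "u \<in> H01 \<Omega>"
  shows "A.nrm u \<le> sqrt c2 * L2_norm \<Omega> (weak_gradient \<Omega> u)"
proof -
  have "A.nrm u \<le> sqrt (c2 * (L2_norm \<Omega> (weak_gradient \<Omega> u))\<^sup>2)"
    unfolding A.nrm_def by (intro real_sqrt_le_mono bounded_form assms)
  then show ?thesis by (simp add: real_sqrt_mult L2_norm_nonneg)
qed

lemma nrm_le_H1_norm:
  assumes "u \<in> H01 \<Omega>"
  shows "A.nrm u \<le> sqrt c2 * H1_norm \<Omega> u"
  by (rule order_trans[OF nrm_le_L2_norm_weak_gradient[OF assms]
        mult_left_mono[OF L2_norm_weak_gradient_le_H1_norm]]) (use c2_pos in simp)

text \<open>Generic in the codomain, for use with the functions themselves and with their
  gradients.\<close>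

lemma L2_cauchy_if_dominated:
  fixes w :: "nat \<Rightarrow> 'a \<Rightarrow> 'b::euclidean_space" and v :: "nat \<Rightarrow> 'a \<Rightarrow> real"
  assumes "\<And>e. e > 0 \<Longrightarrow> \<exists>N. \<forall>m\<ge>N. \<forall>n\<ge>N. A.nrm (\<lambda>x. v m x - v n x) < e"
    and "\<And>m n. L2_norm \<Omega> (\<lambda>x. w m x - w n x) \<le> C * A.nrm (\<lambda>x. v m x - v n x)"
    and "0 \<le> C" "0 < e"
  shows "\<exists>N. \<forall>m\<ge>N. \<forall>n\<ge>N. L2_norm \<Omega> (\<lambda>x. w m x - w n x) < e"
proof -
  obtain N where N: "\<And>m n. m \<ge> N \<Longrightarrow> n \<ge> N \<Longrightarrow> A.nrm (\<lambda>x. v m x - v n x) < e / (C + 1)"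
    using assms(1)[of "e / (C + 1)"] assms(3,4) by auto
  have "L2_norm \<Omega> (\<lambda>x. w m x - w n x) < e" if "m \<ge> N" "n \<ge> N" for m n
  proof -
    have "C * A.nrm (\<lambda>x. v m x - v n x) \<le> C * (e / (C + 1))"
      using N[OF that] assms(3) by (intro mult_left_mono) auto
    also have "\<dots> < e" using assms(3,4) by (simp add: field_simps)
    finally show ?thesis using assms(2)[of m n] by linarith
  qed
  then show ?thesis by blast
qed

text \<open>Coercivity makes the gradients Cauchy in L2, and Poincare the functions. The limit h of
  the gradients is a weak gradient of the limit l, so convergence holds in the H1 norm; closedness
  puts l into \<open>H01\<close>, and the bound with \<open>c2\<close> returns to the energy
  norm.\<close>

lemma H01_complete:
  assumes w: "\<And>n. w n \<in> H01 \<Omega>"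
    and cauchy: "\<And>e. e > 0 \<Longrightarrow> \<exists>N. \<forall>m\<ge>N. \<forall>n\<ge>N. A.nrm (\<lambda>x. w m x - w n x) < e"
  shows "\<exists>l\<in>H01 \<Omega>. (\<lambda>n. A.nrm (\<lambda>x. w n x - l x)) \<longlonglongrightarrow> 0"
proof -
  obtain K where K: "0 \<le> K" "\<And>u. u \<in> H01 \<Omega> \<Longrightarrow> L2_norm \<Omega> u \<le> K * L2_norm \<Omega> (weak_gradient \<Omega> u)"
    using Poincare by blast
  define g where "g n = weak_gradient \<Omega> (w n)" for n
  have gL2: "g n \<in> L2 \<Omega>" for n
    unfolding g_def by (intro weak_gradient_L2 H01_H1 w)
  have grad: "L2_norm \<Omega> (\<lambda>x. g m x - g n x) \<le> 1 / sqrt c1 * A.nrm (\<lambda>x. w m x - w n x)" for m n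
    unfolding g_def L2_norm_weak_gradient_diff[OF H01_H1[OF w] H01_H1[OF w], symmetric]
    using L2_norm_weak_gradient_le_nrm[OF A.diff_mem[OF w w]] by simp
  have fn: "L2_norm \<Omega> (\<lambda>x. w m x - w n x) \<le> K / sqrt c1 * A.nrm (\<lambda>x. w m x - w n x)" for m n
    using K(2)[OF A.diff_mem[OF w w], of m n]
      mult_left_mono[OF L2_norm_weak_gradient_le_nrm[OF A.diff_mem[OF w[of m] w[of n]]] K(1)] by simp
  obtain l where l: "l \<in> L2 \<Omega>" "(\<lambda>n. L2_norm \<Omega> (\<lambda>x. w n x - l x)) \<longlonglongrightarrow> 0"
    using L2_complete[OF lmeasurable_\<Omega> H01_L2[OF w] L2_cauchy_if_dominated[OF cauchy fn]] c1_pos K(1)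
    by auto
  obtain h where h: "h \<in> L2 \<Omega>" "(\<lambda>n. L2_norm \<Omega> (\<lambda>x. g n x - h x)) \<longlonglongrightarrow> 0"
    using L2_complete[OF lmeasurable_\<Omega> gL2 L2_cauchy_if_dominated[OF cauchy grad]] c1_pos by auto
  have lh: "has_weak_gradient \<Omega> l h"
    using has_weak_gradient[OF H01_H1[OF w]] unfolding g_def[symmetric]
    by (intro has_weak_gradient_tendsto[OF H01_L2[OF w] gL2 _ l(1) h(1) l(2) h(2)])
  have lH1: "l \<in> H1 \<Omega>" by (rule H1_I[OF l(1) h(1) lh])
  have "L2_norm \<Omega> (weak_gradient \<Omega> (\<lambda>x. w n x - l x)) = L2_norm \<Omega> (\<lambda>x. g n x - h x)" for n
  proof -
    have "AE x in lebesgue_on \<Omega>. g n x - weak_gradient \<Omega> l x = g n x - h x"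
      using weak_gradient_AE_eq[OF l(1) h(1) lh] by eventually_elim simp
    then show ?thesis
      unfolding L2_norm_weak_gradient_diff[OF H01_H1[OF w] lH1] g_def[symmetric]
      by (intro L2_norm_AE_cong L2_measurable[OF L2.diff_mem[OF gL2 weak_gradient_L2[OF lH1]]]
          L2_measurable[OF L2.diff_mem[OF gL2 h(1)]])
  qed
  then have "(\<lambda>n. H1_norm \<Omega> (\<lambda>x. w n x - l x)) \<longlonglongrightarrow> sqrt (0\<^sup>2 + 0\<^sup>2)"
    unfolding H1_norm_def by (simp only:) (intro tendsto_intros l(2) h(2))
  then have lim: "(\<lambda>n. H1_norm \<Omega> (\<lambda>x. w n x - l x)) \<longlonglongrightarrow> 0" by simp
  have lH01: "l \<in> H01 \<Omega>" by (rule H01_closed[OF w lH1 lim])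
  have "(\<lambda>n. A.nrm (\<lambda>x. w n x - l x)) \<longlonglongrightarrow> 0"
  proof (rule Lim_null_comparison)
    show "\<forall>\<^sub>F n in sequentially. norm (A.nrm (\<lambda>x. w n x - l x)) \<le> sqrt c2 * H1_norm \<Omega> (\<lambda>x. w n x - l x)"
      using nrm_le_H1_norm[OF A.diff_mem[OF w lH01]] A.nrm_nonneg[OF A.diff_mem[OF w lH01]] by simp
    show "(\<lambda>n. sqrt c2 * H1_norm \<Omega> (\<lambda>x. w n x - l x)) \<longlonglongrightarrow> 0"
      using tendsto_mult_left[OF lim, of "sqrt c2"] by simp
  qed
  then show ?thesis using lH01 by blast
qed

text \<open>The functional given by u is bounded in the energy norm, by Cauchy-Schwarz, Poincare and
  coercivity, so Riesz provides a witness for the choice in \<open>solution_op\<close>.\<close>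

lemma solution_op:
  assumes u: "u \<in> L2 \<Omega>"
  shows solution_op_H01: "solution_op \<Omega> \<V> (L2_inner \<Omega> u) \<in> H01 \<Omega>"
    and bilin_solution_op: "v \<in> H01 \<Omega> \<Longrightarrow> bilin \<Omega> \<V> (solution_op \<Omega> \<V> (L2_inner \<Omega> u)) v = L2_inner \<Omega> u v"
proof -
  obtain K where K: "0 \<le> K" "\<And>u. u \<in> H01 \<Omega> \<Longrightarrow> L2_norm \<Omega> u \<le> K * L2_norm \<Omega> (weak_gradient \<Omega> u)"
    using Poincare by blast
  have "\<exists>w\<in>H01 \<Omega>. \<forall>v\<in>H01 \<Omega>. bilin \<Omega> \<V> w v = L2_dot \<Omega> u v"
  proof (rule A.Riesz[where C = "L2_norm \<Omega> u * (K / sqrt c1)"])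
    show "\<bar>L2_dot \<Omega> u v\<bar> \<le> L2_norm \<Omega> u * (K / sqrt c1) * A.nrm v" if v: "v \<in> H01 \<Omega>" for v
    proof -
      have "\<bar>L2_dot \<Omega> u v\<bar> \<le> L2_norm \<Omega> u * L2_norm \<Omega> v"
        by (intro L2.Cauchy_Schwarz u H01_L2 v)
      also have "\<dots> \<le> L2_norm \<Omega> u * (K * (A.nrm v / sqrt c1))"
        using K(2)[OF v] mult_left_mono[OF L2_norm_weak_gradient_le_nrm[OF v] K(1)]
        by (intro mult_left_mono L2_norm_nonneg) linarith
      finally show ?thesis by simp
    qed
    show "L2_dot \<Omega> u (\<lambda>x. v x + w x) = L2_dot \<Omega> u v + L2_dot \<Omega> u w"
      if "v \<in> H01 \<Omega>" "w \<in> H01 \<Omega>" for v w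
      using that by (intro L2.add_right u H01_L2)
    show "L2_dot \<Omega> u (\<lambda>x. c *\<^sub>R v x) = c * L2_dot \<Omega> u v" if "v \<in> H01 \<Omega>" for c v
      using that by (intro L2.scale_right u H01_L2)
  qed (rule H01_complete)
  then have "\<exists>w. w \<in> H01 \<Omega> \<and> (\<forall>v\<in>H01 \<Omega>. bilin \<Omega> \<V> w v = L2_inner \<Omega> u v)"
    by (auto simp: L2_inner_eq_L2_dot)
  from someI_ex[OF this] show "solution_op \<Omega> \<V> (L2_inner \<Omega> u) \<in> H01 \<Omega>"
    "v \<in> H01 \<Omega> \<Longrightarrow> bilin \<Omega> \<V> (solution_op \<Omega> \<V> (L2_inner \<Omega> u)) v = L2_inner \<Omega> u v"
    by (simp_all add: solution_op_def)
qed

text \<open>A null function has gradient norm 0, hence energy norm 0 by the bound with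
  \<open>c2\<close>, and Cauchy-Schwarz removes it from the form. This lets the flow equation, valid
  almost everywhere, be inserted into the energy form.\<close>

lemma bilin_AE_cong:
  assumes "u \<in> H01 \<Omega>" "v \<in> H01 \<Omega>" "w \<in> H01 \<Omega>" "AE x in lebesgue_on \<Omega>. u x = v x"
  shows "bilin \<Omega> \<V> u w = bilin \<Omega> \<V> v w"
proof -
  have mem: "(\<lambda>x. u x - v x) \<in> H01 \<Omega>" by (intro A.diff_mem assms)
  have "AE x in lebesgue_on \<Omega>. u x - v x = 0" using assms(4) by eventually_elim simp
  then have "A.nrm (\<lambda>x. u x - v x) = 0"
    using nrm_le_L2_norm_weak_gradient[OF mem] A.nrm_nonneg[OF mem]
      L2_norm_weak_gradient_AE_0[OF H01_H1[OF mem]] by simp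
  then have "bilin \<Omega> \<V> (\<lambda>x. u x - v x) w = 0"
    using A.Cauchy_Schwarz[OF mem assms(3)] by simp
  then show ?thesis using A.diff_left[OF assms(1-3)] by simp
qed

text \<open>The H1 norm dominates both the L2 norm and, up to the factor sqrt c2, the energy norm,
  so one curve differentiable in H1 is differentiable for both forms.\<close>

lemma has_derivative_forms:
  assumes "t \<in> S"
    and u: "\<And>s. s \<in> S \<Longrightarrow> u s \<in> H01 \<Omega>" "u' \<in> H01 \<Omega>"
      "((\<lambda>s. H1_norm \<Omega> (\<lambda>x. 1 / (s - t) * (u s x - u t x) - u' x)) \<longlongrightarrow> 0) (at t within S)"
    and v: "\<And>s. s \<in> S \<Longrightarrow> v s \<in> H01 \<Omega>" "v' \<in> H01 \<Omega>"
      "((\<lambda>s. H1_norm \<Omega> (\<lambda>x. 1 / (s - t) * (v s x - v t x) - v' x)) \<longlongrightarrow> 0) (at t within S)"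
  shows "((\<lambda>s. L2_dot \<Omega> (u s) (v s)) has_real_derivative L2_dot \<Omega> u' (v t) + L2_dot \<Omega> (u t) v')
      (at t within S)" (is ?L2)
    and "((\<lambda>s. bilin \<Omega> \<V> (u s) (v s)) has_real_derivative bilin \<Omega> \<V> u' (v t) + bilin \<Omega> \<V> (u t) v')
      (at t within S)" (is ?A)
proof -
  have *: "((\<lambda>s. L2_norm \<Omega> (\<lambda>x. (1 / (s - t)) *\<^sub>R (w s x - w t x) - w' x)) \<longlongrightarrow> 0) (at t within S) \<and>
      ((\<lambda>s. A.nrm (\<lambda>x. (1 / (s - t)) *\<^sub>R (w s x - w t x) - w' x)) \<longlongrightarrow> 0) (at t within S)"
    if w: "\<And>s. s \<in> S \<Longrightarrow> w s \<in> H01 \<Omega>" "w' \<in> H01 \<Omega>"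
      "((\<lambda>s. H1_norm \<Omega> (\<lambda>x. 1 / (s - t) * (w s x - w t x) - w' x)) \<longlongrightarrow> 0) (at t within S)" for w w'
  proof
    define r where "r s = (\<lambda>x. (1 / (s - t)) *\<^sub>R (w s x - w t x) - w' x)" for s
    have r: "((\<lambda>s. H1_norm \<Omega> (r s)) \<longlongrightarrow> 0) (at t within S)"
      using w(3) by (simp add: r_def)
    have rH: "r s \<in> H01 \<Omega>" if "s \<in> S" for s
      unfolding r_def by (rule A.diff_mem[OF A.scale_mem[OF A.diff_mem[OF w(1)[OF that] w(1)[OF assms(1)]]] w(2)])
    show "((\<lambda>s. L2_norm \<Omega> (r s)) \<longlongrightarrow> 0) (at t within S)"
      by (rule Lim_null_comparison[OF _ r]) (simp add: L2_norm_nonneg L2_norm_le_H1_norm)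
    have "norm (A.nrm (r s)) \<le> sqrt c2 * H1_norm \<Omega> (r s)" if "s \<in> S" for s
      using nrm_le_H1_norm[OF rH[OF that]] A.nrm_nonneg[OF rH[OF that]] by simp
    then have "\<forall>\<^sub>F s in at t within S. norm (A.nrm (r s)) \<le> sqrt c2 * H1_norm \<Omega> (r s)"
      by (simp add: eventually_at_filter)
    moreover have "((\<lambda>s. sqrt c2 * H1_norm \<Omega> (r s)) \<longlongrightarrow> 0) (at t within S)"
      using tendsto_mult_left[OF r, of "sqrt c2"] by simp
    ultimately show "((\<lambda>s. A.nrm (r s)) \<longlongrightarrow> 0) (at t within S)"
      by (rule Lim_null_comparison)
  qed
  from *[OF u] *[OF v] show ?L2 ?A
    using assms(1) u v
    by (intro L2.has_derivative_form A.has_derivative_form; simp add: H01_L2)+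
qed

end


section \<open>The flow\<close>

lemma tuple_norm_component:
  assumes "\<And>i. 0 \<le> H1_norm \<Omega> (W $ i)"
  shows "H1_norm \<Omega> (W $ k) \<le> tuple_norm \<Omega> W"
proof -
  have "(H1_norm \<Omega> (W $ k))\<^sup>2 \<le> (\<Sum>i\<in>UNIV. (H1_norm \<Omega> (W $ i))\<^sup>2)"
    by (rule member_le_sum) auto
  then show ?thesis unfolding tuple_norm_def by (rule real_le_rsqrt)
qed

lemma L2_inner_commute: "L2_inner \<Omega> u v = L2_inner \<Omega> v u"
  by (simp add: L2_inner_def mult.commute)

lemma H1_norm_nonneg: "0 \<le> H1_norm \<Omega> u"
  by (simp add: H1_norm_def)

lemma C1_curve_component:
  assumes "C1_curve \<Omega> T U U'" "t \<in> time_interval T"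
  shows "U t $ k \<in> H01 \<Omega>" "U' t $ k \<in> H01 \<Omega>"
    and "((\<lambda>s. H1_norm \<Omega> (\<lambda>x. 1 / (s - t) * ((U s $ k) x - (U t $ k) x) - (U' t $ k) x)) \<longlongrightarrow> 0)
      (at t within time_interval T)"
proof -
  show "U t $ k \<in> H01 \<Omega>" "U' t $ k \<in> H01 \<Omega>"
    using assms unfolding C1_curve_def H01_tuples_def by blast+
  define W where "W s = tuple_diff (tuple_scale (1 / (s - t)) (tuple_diff (U s) (U t))) (U' t)" for s
  have lim: "((\<lambda>s. tuple_norm \<Omega> (W s)) \<longlongrightarrow> 0) (at t within time_interval T)"
    using assms unfolding C1_curve_def W_def by blast
  have "((\<lambda>s. H1_norm \<Omega> (W s $ k)) \<longlongrightarrow> 0) (at t within time_interval T)"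
    by (rule Lim_null_comparison[OF _ lim])
      (simp add: H1_norm_nonneg tuple_norm_component)
  then show "((\<lambda>s. H1_norm \<Omega> (\<lambda>x. 1 / (s - t) * ((U s $ k) x - (U t $ k) x) - (U' t $ k) x)) \<longlongrightarrow> 0)
      (at t within time_interval T)"
    by (simp add: W_def tuple_diff_def tuple_scale_def)
qed

lemma convex_time_interval: "convex (time_interval T)"
proof (rule is_interval_convex)
  show "is_interval (time_interval T)"
    unfolding is_interval_1 time_interval_def
    by (auto intro: le_less_trans[OF ereal_less_eq(3)[THEN iffD2]])
qed

section \<open>Algebra of the flow equation at a fixed time\<close>

context elliptic_form
begin

abbreviation \<G> :: "('a \<Rightarrow> real) \<Rightarrow> 'a \<Rightarrow> real" where
  "\<G> u \<equiv> solution_op \<Omega> \<V> (L2_inner \<Omega> u)"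

text \<open>The identity defining \<open>\<G> v\<close> is tested with \<open>\<G> u\<close>. This
  exhibits P as a Gram matrix for a, the form needed for the trace estimate.\<close>

lemma L2_inner_solution_op:
  assumes "u \<in> H01 \<Omega>" "v \<in> H01 \<Omega>"
  shows "L2_inner \<Omega> (\<G> u) v = bilin \<Omega> \<V> (\<G> u) (\<G> v)"
proof -
  note G = solution_op_H01[OF H01_L2[OF assms(1)]] solution_op_H01[OF H01_L2[OF assms(2)]]
  have "L2_inner \<Omega> (\<G> u) v = L2_inner \<Omega> v (\<G> u)"
    by (rule L2_inner_commute)
  also have "\<dots> = bilin \<Omega> \<V> (\<G> v) (\<G> u)"
    by (rule bilin_solution_op[OF H01_L2[OF assms(2)] G(1), symmetric])
  also have "\<dots> = bilin \<Omega> \<V> (\<G> u) (\<G> v)" by (intro A.sym G)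
  finally show ?thesis .
qed

text \<open>Two linear combinations in the shape that \<open>sum_mem\<close> and
  \<open>sum_left\<close> accept.\<close>

lemma flow_rhs_component:
  "flow_rhs \<Omega> \<V> U $ k =
    (\<lambda>x. (\<Sum>i\<in>UNIV. (- L2_inner \<Omega> (\<G> (U $ i)) (U $ k)) *\<^sub>R (U $ i) x)
       + (\<Sum>i\<in>UNIV. L2_inner \<Omega> (U $ i) (U $ k) *\<^sub>R \<G> (U $ i) x))"
  by (simp add: flow_rhs_def Let_def tuple_add_def tuple_scale_def tuple_mult_def gram_def
      solution_op_tuple_def sum_negf mult.commute)

text \<open>U and V stand for the position and the velocity of the curve at one time.\<close>

context
  fixes U :: "('a \<Rightarrow> real)^'n" and V :: "('a \<Rightarrow> real)^'n"
  assumes U: "\<And>i. U $ i \<in> H01 \<Omega>" and V: "\<And>i. V $ i \<in> H01 \<Omega>"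
    and flow: "tuple_eq \<Omega> V (flow_rhs \<Omega> \<V> U)"
begin

lemma flow_AE: "AE x in lebesgue_on \<Omega>. (V $ k) x = (flow_rhs \<Omega> \<V> U $ k) x"
  using flow by (simp add: tuple_eq_def)

lemma solution_op_component: "\<G> (U $ i) \<in> H01 \<Omega>"
  by (intro solution_op_H01 H01_L2 U)

lemma flow_rhs_H01: "flow_rhs \<Omega> \<V> U $ k \<in> H01 \<Omega>"
  unfolding flow_rhs_component by (rule A.add_mem[OF A.sum_mem[OF U] A.sum_mem[OF solution_op_component]])

lemma L2_inner_flow:
  assumes w: "w \<in> H01 \<Omega>"
  shows "L2_inner \<Omega> (V $ k) w =
    - (\<Sum>i\<in>UNIV. L2_inner \<Omega> (\<G> (U $ i)) (U $ k) * L2_inner \<Omega> (U $ i) w)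
    + (\<Sum>i\<in>UNIV. L2_inner \<Omega> (U $ i) (U $ k) * L2_inner \<Omega> (\<G> (U $ i)) w)"
proof -
  note L = H01_L2[OF U] H01_L2[OF solution_op_component] H01_L2[OF w]
  have "L2_inner \<Omega> (V $ k) w = L2_inner \<Omega> (flow_rhs \<Omega> \<V> U $ k) w"
    unfolding L2_inner_eq_L2_dot
    by (rule L2_dot_AE_cong[OF H01_L2[OF V] H01_L2[OF flow_rhs_H01] L(3) L(3) flow_AE]) simp
  also have "\<dots> = (\<Sum>i\<in>UNIV. (- L2_inner \<Omega> (\<G> (U $ i)) (U $ k)) * L2_inner \<Omega> (U $ i) w)
    + (\<Sum>i\<in>UNIV. L2_inner \<Omega> (U $ i) (U $ k) * L2_inner \<Omega> (\<G> (U $ i)) w)"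
    unfolding flow_rhs_component
      L2.add_left[OF L2.sum_mem[OF L(1)] L2.sum_mem[OF L(2)] L(3), folded L2_inner_eq_L2_dot]
      L2.sum_left[OF L(1) L(3), folded L2_inner_eq_L2_dot]
      L2.sum_left[OF L(2) L(3), folded L2_inner_eq_L2_dot] ..
  finally show ?thesis by (simp add: sum_negf)
qed

lemma bilin_flow:
  assumes w: "w \<in> H01 \<Omega>"
  shows "bilin \<Omega> \<V> (V $ k) w =
    - (\<Sum>i\<in>UNIV. L2_inner \<Omega> (\<G> (U $ i)) (U $ k) * bilin \<Omega> \<V> (U $ i) w)
    + (\<Sum>i\<in>UNIV. L2_inner \<Omega> (U $ i) (U $ k) * bilin \<Omega> \<V> (\<G> (U $ i)) w)"
proof -
  note G = solution_op_component
  have "bilin \<Omega> \<V> (V $ k) w = bilin \<Omega> \<V> (flow_rhs \<Omega> \<V> U $ k) w"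
    by (rule bilin_AE_cong[OF V flow_rhs_H01 w flow_AE])
  also have "\<dots> = (\<Sum>i\<in>UNIV. (- L2_inner \<Omega> (\<G> (U $ i)) (U $ k)) * bilin \<Omega> \<V> (U $ i) w)
    + (\<Sum>i\<in>UNIV. L2_inner \<Omega> (U $ i) (U $ k) * bilin \<Omega> \<V> (\<G> (U $ i)) w)"
    unfolding flow_rhs_component A.add_left[OF A.sum_mem[OF U] A.sum_mem[OF G] w]
      A.sum_left[OF U w] A.sum_left[OF G w] ..
  finally show ?thesis by (simp add: sum_negf)
qed

text \<open>Exchanging k and j exchanges the two sums of \<open>L2_inner_flow\<close>, which carry
  opposite signs.\<close>

lemma gram_flow: "L2_inner \<Omega> (V $ k) (U $ j) + L2_inner \<Omega> (U $ k) (V $ j) = 0"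
  unfolding L2_inner_commute[of \<Omega> "U $ k" "V $ j"] L2_inner_flow[OF U] by (simp add: mult.commute)

text \<open>By orthonormality the second sum of \<open>bilin_flow\<close> at w = u_k is a(\<G> u_k,
  u_k) = 1, in total N. The first sums add up to - tr (P S), estimated with x_i = u_i and y_i = \<G>
  u_i as biorthogonal systems.\<close>

lemma energy_flow:
  assumes orth: "gram \<Omega> U U = mat 1"
  shows "(\<Sum>k\<in>UNIV. bilin \<Omega> \<V> (V $ k) (U $ k)) \<le> 0"
proof -
  have \<delta>: "L2_inner \<Omega> (U $ i) (U $ k) = (if i = k then 1 else 0)" for i k
    using arg_cong[OF orth, of "\<lambda>M. M $ i $ k"] by (simp add: gram_def mat_def)
  have G: "bilin \<Omega> \<V> (\<G> (U $ i)) (U $ k) = (if i = k then 1 else 0)" for i k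
    unfolding bilin_solution_op[OF H01_L2[OF U] U] by (rule \<delta>)
  have "real (card (UNIV :: 'n set)) \<le> (\<Sum>i\<in>UNIV. \<Sum>k\<in>UNIV. bilin \<Omega> \<V> (U $ i) (U $ k) *
      bilin \<Omega> \<V> (\<G> (U $ i)) (\<G> (U $ k)))"
    by (rule A.card_le_sum_biorthogonal)
      (auto simp: U solution_op_component G A.sym[OF U solution_op_component])
  also have "\<dots> = (\<Sum>k\<in>UNIV. \<Sum>i\<in>UNIV. L2_inner \<Omega> (\<G> (U $ i)) (U $ k) * bilin \<Omega> \<V> (U $ i) (U $ k))"
    by (subst sum.swap) (simp add: L2_inner_solution_op[OF U U] mult.commute)
  finally show ?thesis
    unfolding bilin_flow[OF U] by (simp add: \<delta> G sum.distrib sum_negf sum_subtractf if_distrib if_distribR cong: if_cong)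
qed

end

end

theorem proposition3p4:
  fixes \<Omega> :: "'a::euclidean_space set"
    and \<V> :: "'a \<Rightarrow> real"
    and c1 c2 :: real
    and T :: ereal
    and U0 :: "('a \<Rightarrow> real)^'n"
    and U U' :: "real \<Rightarrow> ('a \<Rightarrow> real)^'n"
  assumes "open \<Omega>" "connected \<Omega>" "\<Omega> \<noteq> {}" "bounded \<Omega>"
    and "\<And>u v. u \<in> H01 \<Omega> \<Longrightarrow> v \<in> H01 \<Omega> \<Longrightarrow> integrable (lebesgue_on \<Omega>) (\<lambda>x. \<V> x * u x * v x)"
    and "inner_product_on_H01 \<Omega> (bilin \<Omega> \<V>)"
    and "c1 > 0" "c2 > 0"
    and "\<And>u. u \<in> H01 \<Omega> \<Longrightarrow> c1 * (L2_norm \<Omega> (weak_gradient \<Omega> u))\<^sup>2 \<le> bilin \<Omega> \<V> u u"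
    and "\<And>u. u \<in> H01 \<Omega> \<Longrightarrow> bilin \<Omega> \<V> u u \<le> c2 * (L2_norm \<Omega> (weak_gradient \<Omega> u))\<^sup>2"
    and "U0 \<in> orthonormal_tuples \<Omega>"
    and "0 < T"
    and "C1_curve \<Omega> T U U'"
    and "\<And>t. t \<in> time_interval T \<Longrightarrow> tuple_eq \<Omega> (U' t) (flow_rhs \<Omega> \<V> (U t))"
    and "tuple_eq \<Omega> (U 0) U0"
  shows "\<forall>t\<in>time_interval T.
           gram \<Omega> (U t) (U t) = mat 1 \<and>
           (\<exists>D. ((\<lambda>s. energy \<Omega> \<V> (U s)) has_real_derivative D) (at t within time_interval T) \<and> D \<le> 0)"
proof -
  interpret elliptic_form \<Omega> \<V> c1 c2
    by unfold_locales (use assms(1,4,6-10) in blast)+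
  note curve = C1_curve_component[OF assms(13)]
  have zero: "0 \<in> time_interval T" using assms(12) by (simp add: time_interval_def zero_ereal_def)
  have gram0: "L2_inner \<Omega> (U 0 $ i) (U 0 $ j) = mat 1 $ i $ j" for i j
  proof -
    have U0: "U0 $ i \<in> H01 \<Omega>" for i
      using assms(11) by (simp add: orthonormal_tuples_def H01_tuples_def)
    have eq: "AE x in lebesgue_on \<Omega>. (U 0 $ i) x = (U0 $ i) x" for i
      using assms(15) by (simp add: tuple_eq_def)
    \<comment> \<open>The initial condition is an equality almost everywhere, so orthonormality has
      to be carried over to the representative U 0.\<close>
    have "L2_inner \<Omega> (U 0 $ i) (U 0 $ j) = L2_inner \<Omega> (U0 $ i) (U0 $ j)"
      unfolding L2_inner_eq_L2_dot
      by (intro L2_dot_AE_cong H01_L2 curve(1)[OF zero] U0 eq)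
    also have "\<dots> = gram \<Omega> U0 U0 $ i $ j" by (simp add: gram_def)
    also have "\<dots> = mat 1 $ i $ j" using assms(11) by (simp add: orthonormal_tuples_def)
    finally show ?thesis .
  qed
  have gram: "gram \<Omega> (U t) (U t) = mat 1" if t: "t \<in> time_interval T" for t
  proof -
    have "L2_inner \<Omega> (U t $ i) (U t $ j) = mat 1 $ i $ j" for i j
    proof -
      \<comment> \<open>The derivative vanishes within the whole interval, one-sidedly at 0; as the
        interval is convex, the entry is constant.\<close>
      have "((\<lambda>s. L2_inner \<Omega> (U s $ i) (U s $ j)) has_field_derivative 0) (at r within time_interval T)"
        if r: "r \<in> time_interval T" for r
      proof -
        have "((\<lambda>s. L2_inner \<Omega> (U s $ i) (U s $ j)) has_real_derivative
            L2_inner \<Omega> (U' r $ i) (U r $ j) + L2_inner \<Omega> (U r $ i) (U' r $ j)) (at r within time_interval T)"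
          unfolding L2_inner_eq_L2_dot
          by (rule has_derivative_forms(1)[OF r curve(1) curve(2,3)[OF r] curve(1) curve(2,3)[OF r]])
        then show ?thesis
          unfolding gram_flow[OF curve(1)[OF r] curve(2)[OF r] assms(14)[OF r]] .
      qed
      then obtain c where c: "\<forall>s\<in>time_interval T. L2_inner \<Omega> (U s $ i) (U s $ j) = c"
        by (rule exE[OF has_field_derivative_zero_constant[OF convex_time_interval]])
      then have "L2_inner \<Omega> (U t $ i) (U t $ j) = L2_inner \<Omega> (U 0 $ i) (U 0 $ j)"
        using c zero t by simp
      then show ?thesis by (simp only: gram0)
    qed
    then show ?thesis by (simp add: gram_def vec_eq_iff)
  qed
  have "\<exists>D. ((\<lambda>s. energy \<Omega> \<V> (U s)) has_real_derivative D) (at t within time_interval T) \<and> D \<le> 0"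
    if t: "t \<in> time_interval T" for t
  proof (intro exI conjI)
    let ?D = "\<Sum>k\<in>UNIV. bilin \<Omega> \<V> (U' t $ k) (U t $ k)"
    have "((\<lambda>s. energy \<Omega> \<V> (U s)) has_real_derivative
        1 / 2 * (\<Sum>k\<in>UNIV. bilin \<Omega> \<V> (U' t $ k) (U t $ k) + bilin \<Omega> \<V> (U t $ k) (U' t $ k)))
        (at t within time_interval T)"
      unfolding energy_def
      by (intro DERIV_cmult DERIV_sum
          has_derivative_forms(2)[OF t curve(1) curve(2,3)[OF t] curve(1) curve(2,3)[OF t]])
    \<comment> \<open>By symmetry of a the two terms agree, which cancels the factor 1/2 of the
      energy.\<close>
    also have "1 / 2 * (\<Sum>k\<in>UNIV. bilin \<Omega> \<V> (U' t $ k) (U t $ k) + bilin \<Omega> \<V> (U t $ k) (U' t $ k)) = ?D"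
      unfolding A.sym[OF curve(1)[OF t] curve(2)[OF t]] by (simp add: sum_distrib_left)
    finally show "((\<lambda>s. energy \<Omega> \<V> (U s)) has_real_derivative ?D) (at t within time_interval T)" .
    show "?D \<le> 0"
      by (rule energy_flow[OF curve(1)[OF t] curve(2)[OF t] assms(14)[OF t] gram[OF t]])
  qed
  then show ?thesis using gram by blast
qed

end
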